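(* Let $Y=\{Y(t),\ t\in[0,1]\}$ be the unique solution of the functional boundary value problem $$DY(t)+A(t)Y(t)=\dot B(t),\quad t\in[0,1],\qquad \Lambda[Y]=c,$$ where $A$, $B$, $\Lambda$ and $c$ are as described in the context, $\Lambda$ is written in basic form, and the problem is well-posed (i.e. the homogeneous problem $DY+AY=0$, $\Lambda[Y]=0$ has only the trivial solution). Fix $0\le a\le1$ such that $a\notin\operatorname{supp}\Lambda$. Then the $\sigma$-fields $$\sigma\{Y(t),\ t\in[0,a]\}\quad\text{and}\quad\sigma\{Y(t),\ t\in[a,1]\}$$ are conditionally independent given $\sigma\{Y(a)\}$ if and only if for every $i\in\{1,\dots,n\}$ either $\operatorname{supp}\Lambda_i\subset[0,a)$ or $\operatorname{supp}\Lambda_i\subset(a,1]$.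
   Context: Let $n\ge 1$, let $a_0,\dots,a_{n-1}$ be continuous real functions on $[0,1]$, and let $A(t)$ be the $n\times n$ matrix whose first row is $(a_{n-1}(t),a_{n-2}(t),\dots,a_0(t))$, whose entries in positions $(i+1,i)$, $1\le i\le n-1$, are $-1$, and whose remaining entries are $0$. Let $W=\{W(t),\ t\in[0,1]\}$ be the coordinate process on the classical Wiener space ($\Omega=C_0([0,1];\mathbb{R})$, the continuous functions vanishing at $0$, with its Borel $\sigma$-field and Wiener measure $P$), so $W$ is a standard Wiener process, and put $B(t)=(W(t),0,\dots,0)\in\mathbb{R}^n$. (The system is the first order form of an $n$-th order equation $L[X]=\dot W$, $L=D^n+a_{n-1}D^{n-1}+\cdots+a_0$, $D=d/dt$, with $Y_i=D^{n-i}X$, so $Y_n=X$.) Boundary operator: let $m\ge n$, let $0\le t_1<\dots<t_m\le 1$, let $(\alpha_{ij})$ be a real $n\times m$ matrix of full rank $n$, and let $c\in\mathbb{R}^n$. $\Lambda=(\Lambda_1,\dots,\Lambda_n)$ is given by $\Lambda_i[Y]=\sum_{j=1}^m\alpha_{ij}Y_n(t_j)$, where $Y_n$ is the last component of $Y$. Put $\operatorname{supp}\Lambda_i=\{t_j:\alpha_{ij}\ne0\}$ and $\operatorname{supp}\Lambda=\bigcup_i\operatorname{supp}\Lambda_i$. Basic form: $\Lambda$ is written in basic form if there are $n$ columns of $(\alpha_{ij})$ forming (up to a permutation of the columns) the $n\times n$ identity matrix. Any full rank condition can be put in this form by multiplying $(\alpha_{ij})$ and $c$ on the left by the inverse of an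 invertible $n\times n$ submatrix. Solution: under well-posedness, for every $\omega\in\Omega$ the path $Y(\cdot)(\omega)$ is the unique continuous function $[0,1]\to\mathbb{R}^n$ with $Y(t)-Y(0)+\int_0^tA(s)Y(s)\,ds=B(t)$ for all $t\in[0,1]$ and $\Lambda[Y]=c$. *)

theory Defs
  imports "HOL-Probability.Probability"
begin

section \<open>Classical Wiener space\<close>

text \<open>
  The paths are the continuous functions on [0,1] that vanish at 0, with the supremum distance.
  As elements of \<^const>\<open>cfunspace\<close> they are \<^const>\<open>undefined\<close> outside [0,1].
\<close>

definition wiener_paths :: "(real \<Rightarrow> real) metric" where
  "wiener_paths =
     submetric (cfunspace (top_of_set {0..1}) euclidean_metric) {\<omega>. \<omega> 0 = 0}"

definition wiener_borel :: "(real \<Rightarrow> real) measure" where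
  "wiener_borel = sigma (mspace wiener_paths) {U. openin (mtopology_of wiener_paths) U}"

text \<open>
  Wiener measure is the probability on the Borel sets of the path space that makes the coordinate
  process a standard Wiener process: increments over disjoint intervals are independent, and the
  increment from \<open>s\<close> to \<open>t\<close> is normal with mean 0 and variance \<open>t - s\<close>. The third argument of
  \<^const>\<open>normal_density\<close> is the point; the second is the standard deviation.
\<close>

definition wiener_measure :: "(real \<Rightarrow> real) measure \<Rightarrow> bool" where
  "wiener_measure P \<longleftrightarrow>
     prob_space P \<and> sets P = sets wiener_borel \<and>
     (\<forall>s t. 0 \<le> s \<and> s < t \<and> t \<le> 1 \<longrightarrow>
        distributed P lborel (\<lambda>\<omega>. \<omega> t - \<omega> s) (\<lambda>x. ennreal (normal_density 0 (sqrt (t - s)) x))) \<and>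
     (\<forall>(k::nat) (u::nat \<Rightarrow> real). mono_on {..k} u \<and> u ` {..k} \<subseteq> {0..1} \<longrightarrow>
        prob_space.indep_vars P (\<lambda>_. borel) (\<lambda>i \<omega>. \<omega> (u (Suc i)) - \<omega> (u i)) {..<k})"

section \<open>Conditional independence\<close>

definition generated_sigma ::
  "'w set \<Rightarrow> ('i \<Rightarrow> 'w \<Rightarrow> 'b::topological_space) \<Rightarrow> 'i set \<Rightarrow> 'w measure" where
  "generated_sigma \<Omega> X T = sigma \<Omega> {X t -` S \<inter> \<Omega> | t S. t \<in> T \<and> S \<in> sets borel}"

text \<open>
  The library's conditional expectation is identically 0 when its second argument is not a
  subalgebra of the first, so the sub-\<open>\<sigma>\<close>-field requirements are part of the definition.
\<close>

definition cond_indep :: "'w measure \<Rightarrow> 'w measure \<Rightarrow> 'w measure \<Rightarrow> 'w measure \<Rightarrow> bool" where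
  "cond_indep M F G H \<longleftrightarrow>
     subalgebra M F \<and> subalgebra M G \<and> subalgebra M H \<and>
     (\<forall>A\<in>sets F. \<forall>B\<in>sets G. AE \<omega> in M.
        real_cond_exp M H (indicator (A \<inter> B)) \<omega> =
        real_cond_exp M H (indicator A) \<omega> * real_cond_exp M H (indicator B) \<omega>)"

section \<open>The first order system\<close>

text \<open>
  Vectors in \<open>\<real>\<^sup>n\<close> are indexed by an arbitrary finite linearly ordered type with \<open>n\<close> elements;
  \<open>pos i\<close> is the 1-based position of the index \<open>i\<close> in that order, so it runs from 1 to \<open>n\<close>.
\<close>

definition pos :: "'n::{finite,linorder} \<Rightarrow> nat" where
  "pos i = card {..i}"

definition companion ::
  "(nat \<Rightarrow> real \<Rightarrow> real) \<Rightarrow> real \<Rightarrow> real^'n::{finite,linorder}^'n::{finite,linorder}" where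
  "companion a t = (\<chi> i j.
     if pos i = 1 then a (CARD('n) - pos j) t
     else if pos i = pos j + 1 then - 1
     else 0)"

definition noise :: "real \<Rightarrow> (real \<Rightarrow> real) \<Rightarrow> real^'n::{finite,linorder}" where
  "noise t \<omega> = (\<chi> i. if pos i = 1 then \<omega> t else 0)"

definition last_component :: "real^'n::{finite,linorder} \<Rightarrow> real" where
  "last_component v = v $ Max UNIV"

section \<open>The boundary operator\<close>

definition boundary ::
  "real^'m^'n::{finite,linorder} \<Rightarrow> ('m \<Rightarrow> real)
     \<Rightarrow> (real \<Rightarrow> real^'n::{finite,linorder}) \<Rightarrow> real^'n::{finite,linorder}" where
  "boundary \<alpha> \<tau> y = (\<chi> i. \<Sum>j\<in>UNIV. \<alpha> $ i $ j * last_component (y (\<tau> j)))"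

definition boundary_supp :: "real^'m^'n \<Rightarrow> ('m \<Rightarrow> real) \<Rightarrow> 'n \<Rightarrow> real set" where
  "boundary_supp \<alpha> \<tau> i = {\<tau> j | j. \<alpha> $ i $ j \<noteq> 0}"

text \<open>
  The selection \<open>f\<close> of columns need not respect the order of the columns, which accounts for
  identity matrices up to a permutation of the columns.
\<close>

definition basic_form :: "real^'m^'n \<Rightarrow> bool" where
  "basic_form \<alpha> \<longleftrightarrow> (\<exists>f :: 'n \<Rightarrow> 'm. inj f \<and> (\<chi> i k. \<alpha> $ i $ f k) = mat 1)"

definition well_posed ::
  "(nat \<Rightarrow> real \<Rightarrow> real) \<Rightarrow> real^'m^'n::{finite,linorder} \<Rightarrow> ('m \<Rightarrow> real) \<Rightarrow> bool" where
  "well_posed a \<alpha> \<tau> \<longleftrightarrow>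
     (\<forall>y :: real \<Rightarrow> real^'n::{finite,linorder}.
        (\<forall>t\<in>{0..1}. (y has_vector_derivative - (companion a t *v y t)) (at t within {0..1})) \<and>
        boundary \<alpha> \<tau> y = 0 \<longrightarrow>
        (\<forall>t\<in>{0..1}. y t = 0))"

text \<open>
  \<open>\<omega>\<close> is the driving path of the Wiener process and \<open>y\<close> the corresponding path of the solution.
\<close>

definition path_solution ::
  "(nat \<Rightarrow> real \<Rightarrow> real) \<Rightarrow> real^'m^'n::{finite,linorder} \<Rightarrow> ('m \<Rightarrow> real) \<Rightarrow> real^'n::{finite,linorder}
     \<Rightarrow> (real \<Rightarrow> real) \<Rightarrow> (real \<Rightarrow> real^'n::{finite,linorder}) \<Rightarrow> bool" where
  "path_solution a \<alpha> \<tau> c \<omega> y \<longleftrightarrow>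
     continuous_on {0..1} y \<and>
     (\<forall>t\<in>{0..1}. y t - y 0 + integral {0..t} (\<lambda>s. companion a s *v y s) = noise t \<omega>) \<and>
     boundary \<alpha> \<tau> y = c"

end

theory Submission
  imports Defs
begin

text \<open>
  Write \<open>Y = Z + \<Sum>\<^sub>k Q\<^sub>k \<psi>\<^sub>k\<close>, where \<open>Z\<close> solves the equation with \<open>Z(p) = 0\<close>, the \<open>\<psi>\<^sub>k\<close> solve the
  homogeneous equation with \<open>\<Lambda>[\<psi>\<^sub>k] = e\<^sub>k\<close>, and \<open>Q\<close> is an invertible linear image of \<open>Y(p)\<close>; then
  \<open>Q = c - \<Lambda>[Z]\<close>. Picard iteration shows that \<open>Z\<close> to the left (right) of \<open>p\<close> depends only on the
  increments of \<open>W\<close> to the left (right) of \<open>p\<close>. If every row of \<open>\<Lambda>\<close> is one-sided, each \<open>Q\<^sub>i\<close> is a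
  function of one of these two independent families, and conditional independence given \<open>Q\<close> follows.

  Conversely, let row \<open>i\<close> be two-sided. Its left part \<open>X\<close>, the sum of \<open>\<alpha>\<^sub>i\<^sub>j Y\<^sub>n(\<tau>\<^sub>j)\<close> over
  \<open>\<tau>\<^sub>j < p\<close>, is measurable for the past and, by the boundary condition, for the future. Under conditional independence \<open>{X \<le> r}\<close> is therefore,
  up to a null set, an event of \<open>\<sigma>{Y(p)}\<close>. But a smooth shift of \<open>W\<close> changes \<open>X\<close> by a constant
  \<open>\<kappa> \<noteq> 0\<close> and leaves \<open>Y(p)\<close> alone, and it preserves null sets (Cameron-Martin), so
  \<open>X \<le> r \<longleftrightarrow> X + \<kappa> \<le> r\<close> almost surely for all rational \<open>r\<close>, which is absurd.
\<close>

text \<open>Two obstacles shape the proof. \<open>Y\<close> is given only path by path, so neither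
  its measurability nor its one-sided dependence on the noise can be read off; both come from
  writing solutions as limits of Picard iterates based at \<open>p\<close>, which see only the times
  between \<open>p\<close> and \<open>t\<close>. The homogeneous solutions are in turn extracted
  from \<open>Y\<close>: when the noise is shifted by the control of a polynomial path
  \<open>q\<close>, the difference of the two solutions minus that path is homogeneous and has
  boundary value -Lambda[q]. Basic form and interpolation realise every boundary value in this way.

  Absolute continuity of the shifted law is drawn from finite dimensions. On a finite time grid the
  shift has a Gaussian density whose second moment is at most exp(C^2), where C is a Lipschitz
  constant of the shift, and this bound is the same for all grids. It therefore passes from the
  algebra of finite dimensional events to the sigma-field of the coordinates. That \<open>p\<close>
  lies outside the support allows a path to vanish at \<open>p\<close> together with its first
  derivatives while taking prescribed values on the support.\<close>

lemma space_generated_sigma [simp]: "space (generated_sigma \<Omega> X T) = \<Omega>"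
  by (simp add: generated_sigma_def space_measure_of_conv)

lemma sets_generated_sigma:
  "sets (generated_sigma \<Omega> X T) =
     sigma_sets \<Omega> {X t -` S \<inter> \<Omega> | t S. t \<in> T \<and> S \<in> sets borel}"
  unfolding generated_sigma_def by (rule sets_measure_of) auto

lemma measurable_generated_sigma:
  fixes X :: "'i \<Rightarrow> 'w \<Rightarrow> 'b::topological_space"
  assumes "t \<in> T"
  shows "X t \<in> borel_measurable (generated_sigma \<Omega> X T)"
proof (rule measurableI)
  fix S :: "'b set" assume "S \<in> sets borel"
  then show "X t -` S \<inter> space (generated_sigma \<Omega> X T) \<in> sets (generated_sigma \<Omega> X T)"
    unfolding sets_generated_sigma using assms by (auto intro!: sigma_sets.Basic)
qed simp

lemma sets_generated_sigma_subset:
  assumes "space N = \<Omega>" and "\<And>t. t \<in> T \<Longrightarrow> X t \<in> borel_measurable N"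
  shows "sets (generated_sigma \<Omega> X T) \<subseteq> sets N"
  unfolding sets_generated_sigma assms(1)[symmetric]
  by (rule sets.sigma_sets_subset) (auto intro: measurable_sets assms(2))

lemma subalgebra_generated_sigma:
  assumes "space N = \<Omega>" and "\<And>t. t \<in> T \<Longrightarrow> X t \<in> borel_measurable N"
  shows "subalgebra N (generated_sigma \<Omega> X T)"
  unfolding subalgebra_def using sets_generated_sigma_subset[OF assms] assms(1) by simp

lemma generated_sigma_mono:
  "T \<subseteq> T' \<Longrightarrow> sets (generated_sigma \<Omega> X T) \<subseteq> sets (generated_sigma \<Omega> X T')"
  by (intro sets_generated_sigma_subset measurable_generated_sigma) auto

lemma sets_generated_sigma_singleton:
  "sets (generated_sigma \<Omega> X {t}) = {X t -` S \<inter> \<Omega> | S. S \<in> sets borel}"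
proof -
  have "sets (generated_sigma \<Omega> X {t}) = sets (vimage_algebra \<Omega> (X t) borel)"
    by (auto simp: sets_generated_sigma sets_vimage_algebra intro!: arg_cong2[where f=sigma_sets])
  also have "\<dots> = {X t -` S \<inter> \<Omega> | S. S \<in> sets borel}"
    by (rule sets_vimage_algebra2) simp
  finally show ?thesis .
qed

section \<open>Conditional independence\<close>

lemma Int_stable_Int_sets: "Int_stable {a \<inter> b | a b. a \<in> sets X \<and> b \<in> sets Y}"
proof (rule Int_stableI)
  fix u v assume "u \<in> {a \<inter> b | a b. a \<in> sets X \<and> b \<in> sets Y}" "v \<in> {a \<inter> b | a b. a \<in> sets X \<and> b \<in> sets Y}"
  then obtain a b a' b' where "u = a \<inter> b" "v = a' \<inter> b'" "a \<in> sets X" "a' \<in> sets X" "b \<in> sets Y" "b' \<in> sets Y"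
    by auto
  then have "u \<inter> v = (a \<inter> a') \<inter> (b \<inter> b')" "a \<inter> a' \<in> sets X" "b \<inter> b' \<in> sets Y" by auto
  then show "u \<inter> v \<in> {a \<inter> b | a b. a \<in> sets X \<and> b \<in> sets Y}" by blast
qed

text \<open>Intersections form a pi-system, which a union of two sigma-fields in general does not,
  so statements about the join can be checked on events \<open>a \<inter> b\<close> by a Dynkin
  argument.\<close>

lemma sigma_sets_Un_eq_Int:
  assumes "space X = \<Omega>" and "space Y = \<Omega>"
  shows "sigma_sets \<Omega> (sets X \<union> sets Y) = sigma_sets \<Omega> {a \<inter> b | a b. a \<in> sets X \<and> b \<in> sets Y}"
proof (rule sigma_sets_eqI)
  fix a assume a: "a \<in> sets X \<union> sets Y"
  have "\<Omega> \<in> sets X" "\<Omega> \<in> sets Y" using assms sets.top[of X] sets.top[of Y] by auto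
  moreover have "a = a \<inter> \<Omega>" "a = \<Omega> \<inter> a"
    using a assms sets.sets_into_space[of a X] sets.sets_into_space[of a Y] by auto
  ultimately have "a \<in> {a \<inter> b | a b. a \<in> sets X \<and> b \<in> sets Y}"
    using a by blast
  then show "a \<in> sigma_sets \<Omega> {a \<inter> b | a b. a \<in> sets X \<and> b \<in> sets Y}" by auto
next
  fix u assume "u \<in> {a \<inter> b | a b. a \<in> sets X \<and> b \<in> sets Y}"
  then obtain a b where ab: "u = a \<inter> b" "a \<in> sets X" "b \<in> sets Y" by auto
  interpret sigma_algebra \<Omega> "sigma_sets \<Omega> (sets X \<union> sets Y)"
    by (rule sigma_algebra_sigma_sets) (use assms sets.space_closed in blast)
  have "a \<in> sigma_sets \<Omega> (sets X \<union> sets Y)" "b \<in> sigma_sets \<Omega> (sets X \<union> sets Y)"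
    using ab by auto
  then show "u \<in> sigma_sets \<Omega> (sets X \<union> sets Y)"
    unfolding ab(1) by (rule Int)
qed

text \<open>As functions of \<open>B\<close> both sides are finite and countably additive, so
  agreement on a pi-system spreads to the generated sigma-field; \<open>space M \<in> E\<close>
  handles complements. With \<open>f\<close> a candidate for a conditional probability of
  \<open>A\<close>, only generators remain to be checked.\<close>

lemma (in prob_space) prob_eq_integral_extend:
  assumes f: "integrable M f"
    and E: "Int_stable E" "E \<subseteq> Pow (space M)" "sigma_sets (space M) E \<subseteq> events" "space M \<in> E"
    and A: "A \<in> events"
    and eq: "\<And>B. B \<in> E \<Longrightarrow> prob (A \<inter> B) = (\<integral>x\<in>B. f x \<partial>M)"
    and B: "B \<in> sigma_sets (space M) E"
  shows "prob (A \<inter> B) = (\<integral>x\<in>B. f x \<partial>M)"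
proof -
  have si: "set_integrable M B f" if "B \<in> events" for B
    using integrable_mult_indicator[OF that f] unfolding set_integrable_def .
  show ?thesis using E(1,2) B
  proof (induct rule: sigma_sets_induct_disjoint)
    case (basic B) then show ?case by (rule eq)
  next
    case empty show ?case by (simp add: set_lebesgue_integral_def)
  next
    case (compl B)
    have Bev: "B \<in> events" using compl E(3) by auto
    have "prob (A \<inter> (space M - B)) = prob (A \<inter> space M) - prob (A \<inter> B)"
      using A Bev by (subst finite_measure_Diff[symmetric]) (auto intro!: arg_cong[where f=prob] dest: sets.sets_into_space)
    also have "\<dots> = (\<integral>x\<in>space M. f x \<partial>M) - (\<integral>x\<in>B. f x \<partial>M)"
      using eq[OF E(4)] compl by simp
    also have "\<dots> = (\<integral>x\<in>space M - B. f x \<partial>M)"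
    proof -
      have "(\<integral>x\<in>(space M - B) \<union> B. f x \<partial>M) = (\<integral>x\<in>space M - B. f x \<partial>M) + (\<integral>x\<in>B. f x \<partial>M)"
        using Bev by (intro set_integral_Un si) auto
      moreover have "(space M - B) \<union> B = space M" using sets.sets_into_space[OF Bev] by auto
      ultimately show ?thesis by simp
    qed
    finally show ?case .
  next
    case (union B)
    have Bev: "range B \<subseteq> events" using union E(3) by auto
    have "(\<lambda>i. prob (A \<inter> B i)) sums prob (\<Union>i. A \<inter> B i)"
      using Bev A union(1) by (intro finite_measure_UNION) (auto simp: disjoint_family_on_def)
    moreover have "(\<integral>x\<in>(\<Union>i. B i). f x \<partial>M) = (\<Sum>i. (\<integral>x\<in>B i. f x \<partial>M))"
      using Bev union(1) by (intro lebesgue_integral_countable_add si) (auto simp: disjoint_family_on_def)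
    ultimately have "prob (\<Union>i. A \<inter> B i) = (\<integral>x\<in>(\<Union>i. B i). f x \<partial>M)"
      using union(3) by (simp add: sums_iff)
    then show ?case by simp
  qed
qed

lemma (in prob_space) real_cond_exp_indicator_indep:
  assumes "subalgebra M R" and "A \<in> events"
    and "\<And>B. B \<in> sets R \<Longrightarrow> prob (A \<inter> B) = prob A * prob B"
  shows "AE x in M. real_cond_exp M R (indicator A) x = prob A"
proof -
  interpret R: finite_measure_subalgebra M R
    using assms(1) by unfold_locales
  have [measurable]: "\<And>B. B \<in> sets R \<Longrightarrow> B \<in> events"
    using assms(1) by (auto simp: subalgebra_def)
  show ?thesis
  proof (rule R.real_cond_exp_charact)
    fix B assume B: "B \<in> sets R"
    have "(\<integral>x\<in>B. indicator A x \<partial>M) = (\<integral>x. indicator (A \<inter> B) x \<partial>M :: real)"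
      unfolding set_lebesgue_integral_def
      by (intro Bochner_Integration.integral_cong) (auto simp: indicator_def)
    also have "\<dots> = prob (A \<inter> B)" using assms(2) B by simp
    also have "\<dots> = (\<integral>x\<in>B. prob A \<partial>M)"
      using assms(3)[OF B] B by (simp add: set_lebesgue_integral_def)
    finally show "(\<integral>x\<in>B. indicator A x \<partial>M) = (\<integral>x\<in>B. prob A \<partial>M)" .
  qed (use assms(2) in \<open>auto simp: integrable_real_indicator emeasure_eq_measure\<close>)
qed

text \<open>The indicator of \<open>A\<close> may be replaced by its conditional expectation given
  \<open>R\<close>, which is the constant \<open>prob A\<close>.\<close>

lemma (in prob_space) integral_indicator_mult_indep:
  assumes R: "subalgebra M R" and A: "A \<in> events"
    and ind: "\<And>B. B \<in> sets R \<Longrightarrow> prob (A \<inter> B) = prob A * prob B"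
    and g: "g \<in> borel_measurable R" "integrable M g"
  shows "(\<integral>x. g x * indicator A x \<partial>M) = prob A * (\<integral>x. g x \<partial>M)"
proof -
  interpret R: finite_measure_subalgebra M R
    using R by unfold_locales
  have int: "integrable M (\<lambda>x. g x * indicator A x)"
    using A g by (intro integrable_real_mult_indicator)
  have "(\<integral>x. g x * indicator A x \<partial>M) = (\<integral>x. g x * real_cond_exp M R (indicator A) x \<partial>M)"
    by (rule R.real_cond_exp_intg(2)[symmetric]) (use int g A in auto)
  also have "\<dots> = (\<integral>x. g x * prob A \<partial>M)"
    using real_cond_exp_indicator_indep[OF R A ind] R.real_cond_exp_intg(1)[OF int g(1)] A g
      measurable_from_subalg[OF R g(1)]
    by (intro integral_cong_AE) auto
  finally show ?thesis by simp
qed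

text \<open>\<open>L\<close> and \<open>R\<close> stand for the noise before and after
  \<open>p\<close>, \<open>H1\<close> and \<open>H2\<close> for the parts of \<open>H\<close>
  determined by \<open>L\<close> and by \<open>R\<close>. Conditioning an event of \<open>R\<close>
  joined with \<open>H1\<close> on \<open>L\<close> joined with \<open>H2\<close> gives an
  \<open>H\<close>-measurable result: \<open>L\<close> only tells which events of \<open>H1\<close>
  occur, and about \<open>R\<close> only \<open>H2\<close> is known. So the past adds nothing to
  \<open>H\<close>.\<close>

lemma (in prob_space) cond_indep_of_indep:
  assumes sub: "subalgebra M L" "subalgebra M R" "subalgebra M H" "subalgebra M F" "subalgebra M G"
    and sub': "subalgebra L H1" "subalgebra R H2" "subalgebra H H1" "subalgebra H H2"
    and ind: "\<And>A B. A \<in> sets L \<Longrightarrow> B \<in> sets R \<Longrightarrow> prob (A \<inter> B) = prob A * prob B"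
    and H: "sets H \<subseteq> sigma_sets (space M) (sets H1 \<union> sets H2)"
    and F: "sets F \<subseteq> sigma_sets (space M) (sets L \<union> sets H2)"
    and G: "sets G \<subseteq> sigma_sets (space M) (sets R \<union> sets H1)"
  shows "cond_indep M F G H"
proof -
  interpret H: finite_measure_subalgebra M H using sub(3) by unfold_locales
  have subH2: "subalgebra M H2" using sub(2) sub'(2) by (auto simp: subalgebra_def)
  interpret H2: finite_measure_subalgebra M H2 using subH2 by unfold_locales
  have sp: "space L = space M" "space R = space M" "space H1 = space M" "space H2 = space M"
    "space H = space M"
    using sub sub' by (auto simp: subalgebra_def)
  have ev: "A \<in> events" if "A \<in> sets L \<or> A \<in> sets R \<or> A \<in> sets H1 \<or> A \<in> sets H2 \<or> A \<in> sets H" for A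
    using that sub sub' by (auto simp: subalgebra_def)
  let ?gL = "{a \<inter> b | a b. a \<in> sets L \<and> b \<in> sets H2}"
  let ?gR = "{a \<inter> b | a b. a \<in> sets R \<and> b \<in> sets H1}"
  have gL: "Int_stable ?gL" "?gL \<subseteq> Pow (space M)" "sigma_sets (space M) ?gL \<subseteq> events" "space M \<in> ?gL"
    using ev sets.sets_into_space sets.top[of L] sets.top[of H2] sp
    by (auto intro!: Int_stable_Int_sets sets.sigma_sets_subset)
  have gR: "Int_stable ?gR" "?gR \<subseteq> Pow (space M)" "sigma_sets (space M) ?gR \<subseteq> events" "space M \<in> ?gR"
    using ev sets.sets_into_space sets.top[of R] sets.top[of H1] sp
    by (auto intro!: Int_stable_Int_sets sets.sigma_sets_subset)
  have FL: "sets F \<subseteq> sigma_sets (space M) ?gL"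
    using F by (simp add: sigma_sets_Un_eq_Int[OF sp(1,4)])
  have GR: "sets G \<subseteq> sigma_sets (space M) ?gR"
    using G by (simp add: sigma_sets_Un_eq_Int[OF sp(2,3)])
  have sH: "sets H \<subseteq> sigma_sets (space M) ?gL" "sets H \<subseteq> sigma_sets (space M) ?gR"
  proof -
    have "sigma_sets (space M) (sets H1 \<union> sets H2) \<subseteq> sigma_sets (space M) (sets L \<union> sets H2)"
      "sigma_sets (space M) (sets H1 \<union> sets H2) \<subseteq> sigma_sets (space M) (sets R \<union> sets H1)"
      using sub' by (auto intro!: sigma_sets_mono' simp: subalgebra_def)
    then show "sets H \<subseteq> sigma_sets (space M) ?gL" "sets H \<subseteq> sigma_sets (space M) ?gR"
      using H by (simp_all add: sigma_sets_Un_eq_Int[OF sp(1,4)] sigma_sets_Un_eq_Int[OF sp(2,3)])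
  qed
  let ?e = "\<lambda>A. real_cond_exp M H (indicator A)"
  have int1: "integrable M (indicator A :: _ \<Rightarrow> real)" if "A \<in> events" for A
    using that by (simp add: integrable_real_indicator emeasure_eq_measure)
  have setint: "(\<integral>x\<in>B. indicator A x \<partial>M) = prob (A \<inter> B)" if "A \<in> events" "B \<in> events" for A B
  proof -
    have "(\<integral>x\<in>B. indicator A x \<partial>M) = (\<integral>x. indicator (A \<inter> B) x \<partial>M :: real)"
      unfolding set_lebesgue_integral_def
      by (intro Bochner_Integration.integral_cong) (auto simp: indicator_def)
    then show ?thesis using that by simp
  qed
  \<comment> \<open>The function 1_D P(B | \<open>H2\<close>) is the conditional probability of
    \<open>B \<inter> D\<close> given \<open>L\<close> joined with \<open>H2\<close>. On a generator
    \<open>a \<inter> d\<close> the event regroups into \<open>a \<inter> D\<close> in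
    \<open>L\<close> and \<open>d \<inter> B\<close> in \<open>R\<close>, which are
    independent.\<close>
  have step1: "prob ((B \<inter> D) \<inter> A) = (\<integral>x\<in>A. indicator D x * real_cond_exp M H2 (indicator B) x \<partial>M)"
    if B: "B \<in> sets R" and D: "D \<in> sets H1" and A: "A \<in> sigma_sets (space M) ?gL" for A B D
  proof (rule prob_eq_integral_extend[OF _ gL _ _ A])
    let ?q = "real_cond_exp M H2 (indicator B)"
    have q: "integrable M ?q" "?q \<in> borel_measurable H2"
      using H2.real_cond_exp_int(1) int1 ev B by auto
    show "integrable M (\<lambda>x. indicator D x * ?q x)"
      using integrable_mult_indicator[OF ev q(1), of D] D by simp
    show "B \<inter> D \<in> events" using ev B D by auto
    fix u assume "u \<in> ?gL"
    then obtain a d where u: "u = a \<inter> d" "a \<in> sets L" "d \<in> sets H2" by auto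
    have aD: "a \<inter> D \<in> sets L" and dB: "d \<inter> B \<in> sets R"
      using u B D sub' by (auto simp: subalgebra_def)
    have qd: "(\<lambda>x. indicator d x * ?q x) \<in> borel_measurable H2" "integrable M (\<lambda>x. indicator d x * ?q x)"
      using integrable_mult_indicator[OF ev q(1), of d] u q by auto
    have "prob ((B \<inter> D) \<inter> u) = prob ((a \<inter> D) \<inter> (d \<inter> B))"
      unfolding u by (rule arg_cong[where f=prob]) auto
    also have "\<dots> = prob (a \<inter> D) * prob (B \<inter> d)"
      using ind[OF aD dB] by (simp add: Int_commute)
    also have "prob (B \<inter> d) = (\<integral>x\<in>d. ?q x \<partial>M)"
      using H2.real_cond_exp_intA[OF int1 u(3)] setint ev B u by simp
    also have "prob (a \<inter> D) * \<dots> = (\<integral>x. (indicator d x * ?q x) * indicator (a \<inter> D) x \<partial>M)"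
      using qd measurable_from_subalg[OF sub'(2)]
      by (subst integral_indicator_mult_indep[OF sub(2) ev ind])
         (use aD in \<open>auto simp: set_lebesgue_integral_def\<close>)
    also have "\<dots> = (\<integral>x\<in>u. indicator D x * ?q x \<partial>M)"
      unfolding set_lebesgue_integral_def u
      by (intro Bochner_Integration.integral_cong) (auto simp: indicator_def)
    finally show "prob ((B \<inter> D) \<inter> u) = (\<integral>x\<in>u. indicator D x * ?q x \<partial>M)" .
  qed
  \<comment> \<open>Restricting \<open>step1\<close> to events of \<open>H\<close> identifies the
    same function as the conditional probability given \<open>H\<close>. Self-adjointness of
    conditional expectation then moves the conditioning from \<open>B \<inter> D\<close> to
    \<open>A\<close>.\<close>
  have step2: "prob (A \<inter> (B \<inter> D)) = (\<integral>x\<in>B \<inter> D. ?e A x \<partial>M)"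
    if B: "B \<in> sets R" and D: "D \<in> sets H1" and A: "A \<in> sigma_sets (space M) ?gL" for A B D
  proof -
    let ?q = "real_cond_exp M H2 (indicator B)"
    have q: "integrable M ?q" "?q \<in> borel_measurable H2"
      using H2.real_cond_exp_int(1) int1 ev B by auto
    have qD: "integrable M (\<lambda>x. indicator D x * ?q x)"
      using integrable_mult_indicator[OF ev q(1), of D] D by simp
    have qDH: "(\<lambda>x. indicator D x * ?q x) \<in> borel_measurable H"
      using D sub' measurable_from_subalg[OF sub'(4) q(2)]
      by (auto simp: subalgebra_def)
    have BD: "B \<inter> D \<in> events" using ev B D by auto
    have Aev: "A \<in> events" using A gL(3) by auto
    have AE_q: "AE x in M. ?e (B \<inter> D) x = indicator D x * ?q x"
    proof (rule H.real_cond_exp_charact[OF _ int1[OF BD] qD qDH])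
      fix C assume C: "C \<in> sets H"
      show "(\<integral>x\<in>C. indicator (B \<inter> D) x \<partial>M) = (\<integral>x\<in>C. indicator D x * ?q x \<partial>M)"
        using step1[OF B D] C sH setint[OF BD ev, of C] by (simp add: subset_iff)
    qed
    have iA: "integrable M (\<lambda>x. ?e A x * indicator (B \<inter> D) x)"
      using H.real_cond_exp_int(1)[OF int1[OF Aev]] BD by (intro integrable_real_mult_indicator)
    have iqA: "integrable M (\<lambda>x. indicator A x * (indicator D x * ?q x))"
      using integrable_mult_indicator[OF Aev qD] by simp
    have eBD: "?e (B \<inter> D) \<in> borel_measurable M" "?e A \<in> borel_measurable M"
      using measurable_from_subalg[OF sub(3) borel_measurable_cond_exp] by auto
    have iBA: "integrable M (\<lambda>x. ?e (B \<inter> D) x * indicator A x)"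
      using iqA by (rule integrable_cong_AE_imp) (use AE_q eBD Aev in auto)
    have "prob (A \<inter> (B \<inter> D)) = (\<integral>x\<in>A. indicator D x * ?q x \<partial>M)"
      using step1[OF B D A] by (simp add: Int_ac)
    also have "\<dots> = (\<integral>x. ?e (B \<inter> D) x * indicator A x \<partial>M)"
      unfolding set_lebesgue_integral_def
      by (intro integral_cong_AE) (use AE_q eBD Aev iqA in auto)
    also have "\<dots> = (\<integral>x. ?e (B \<inter> D) x * ?e A x \<partial>M)"
      by (rule H.real_cond_exp_intg(2)[symmetric]) (use iBA Aev in auto)
    also have "\<dots> = (\<integral>x. ?e A x * ?e (B \<inter> D) x \<partial>M)"
      by (simp add: mult.commute)
    also have "\<dots> = (\<integral>x. ?e A x * indicator (B \<inter> D) x \<partial>M)"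
      by (rule H.real_cond_exp_intg(2)) (use iA BD in auto)
    finally show ?thesis
      by (simp add: set_lebesgue_integral_def mult.commute)
  qed
  have step3: "prob (A \<inter> B) = (\<integral>x\<in>B. ?e A x \<partial>M)"
    if A: "A \<in> sigma_sets (space M) ?gL" and B: "B \<in> sigma_sets (space M) ?gR" for A B
  proof (rule prob_eq_integral_extend[OF _ gR _ _ B])
    show Aev: "A \<in> events" using A gL(3) by auto
    show "integrable M (?e A)" using H.real_cond_exp_int(1)[OF int1[OF Aev]] .
  qed (use step2 A in auto)
  show ?thesis
    unfolding cond_indep_def
  proof (intro conjI ballI sub)
    fix A B assume "A \<in> sets F" "B \<in> sets G"
    then have A: "A \<in> sigma_sets (space M) ?gL" and B: "B \<in> sigma_sets (space M) ?gR"
      using FL GR by auto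
    then have Aev: "A \<in> events" and Bev: "B \<in> events" using gL(3) gR(3) by auto
    have m: "?e A \<in> borel_measurable H" "?e B \<in> borel_measurable H" by auto
    have iC: "integrable M (\<lambda>x. (indicator C x * ?e A x) * indicator B x)"
      if "C \<in> events" for C
      using integrable_real_mult_indicator[OF Bev integrable_mult_indicator[OF that H.real_cond_exp_int(1)[OF int1[OF Aev]]]]
      by simp
    show "AE \<omega> in M. ?e (A \<inter> B) \<omega> = ?e A \<omega> * ?e B \<omega>"
    proof (rule H.real_cond_exp_charact)
      show "(\<lambda>\<omega>. ?e A \<omega> * ?e B \<omega>) \<in> borel_measurable H" using m by measurable
      show "integrable M (indicator (A \<inter> B) :: _ \<Rightarrow> real)" using Aev Bev by (intro int1) auto
      show "integrable M (\<lambda>\<omega>. ?e A \<omega> * ?e B \<omega>)"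
        using H.real_cond_exp_intg(1)[of "?e A" "indicator B"]
          integrable_real_mult_indicator[OF Bev H.real_cond_exp_int(1)[OF int1[OF Aev]]] m Bev
        by auto
      fix C assume C: "C \<in> sets H"
      have Cev: "C \<in> events" using C ev by auto
      \<comment> \<open>Localising to \<open>C\<close> in \<open>H\<close> is free: \<open>H\<close>
        lies in \<open>R\<close> joined with \<open>H1\<close>, so \<open>step3\<close> applies to
        \<open>B \<inter> C\<close> as well.\<close>
      have BC: "B \<inter> C \<in> sigma_sets (space M) ?gR"
      proof -
        interpret sigma_algebra "space M" "sigma_sets (space M) ?gR"
          using gR(2) by (rule sigma_algebra_sigma_sets)
        show ?thesis using B C sH by auto
      qed
      have "(\<integral>x\<in>C. indicator (A \<inter> B) x \<partial>M) = prob (A \<inter> (B \<inter> C))"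
        using setint[of "A \<inter> B" C] Aev Bev Cev by (simp add: Int_ac)
      also have "\<dots> = (\<integral>x\<in>B \<inter> C. ?e A x \<partial>M)" by (rule step3[OF A BC])
      also have "\<dots> = (\<integral>x. (indicator C x * ?e A x) * indicator B x \<partial>M)"
        unfolding set_lebesgue_integral_def
        by (intro Bochner_Integration.integral_cong) (auto simp: indicator_def)
      also have "\<dots> = (\<integral>x. (indicator C x * ?e A x) * ?e B x \<partial>M)"
        by (rule H.real_cond_exp_intg(2)[symmetric]) (use iC[OF Cev] m C Bev in auto)
      finally show "(\<integral>x\<in>C. indicator (A \<inter> B) x \<partial>M) = (\<integral>x\<in>C. ?e A x * ?e B x \<partial>M)"
        by (simp add: set_lebesgue_integral_def mult.assoc)
    qed
  qed
qed

text \<open>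
  The conditional probability of \<open>A\<close> equals its own square, so it is the indicator of an event.
\<close>
lemma (in prob_space) cond_indep_common_event:
  assumes ci: "cond_indep M F G H" and A: "A \<in> sets F" "A \<in> sets G"
  obtains D where "D \<in> sets H" and "AE \<omega> in M. \<omega> \<in> A \<longleftrightarrow> \<omega> \<in> D"
proof -
  have H: "subalgebra M H" and Aev: "A \<in> events"
    using ci A by (auto simp: cond_indep_def subalgebra_def)
  interpret H: finite_measure_subalgebra M H using H by unfold_locales
  define e where "e = real_cond_exp M H (indicator A)"
  have e2: "AE \<omega> in M. e \<omega> = e \<omega> * e \<omega>"
    using ci A unfolding cond_indep_def e_def by force
  have int1: "integrable M (indicator A :: _ \<Rightarrow> real)"
    using Aev by (simp add: integrable_real_indicator emeasure_eq_measure)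
  have [measurable]: "e \<in> borel_measurable H" "e \<in> borel_measurable M"
    using measurable_from_subalg[OF H borel_measurable_cond_exp] by (auto simp: e_def)
  have ie: "integrable M e" unfolding e_def by (rule H.real_cond_exp_int(1)[OF int1])
  have iee: "integrable M (\<lambda>x. e x * e x)"
    by (rule integrable_cong_AE_imp[OF ie]) (use e2 in auto)
  have ieA: "integrable M (\<lambda>x. e x * indicator A x)"
    using Aev ie by (rule integrable_real_mult_indicator)
  have "(\<integral>x. e x * indicator A x \<partial>M) = (\<integral>x. e x * e x \<partial>M)"
    using H.real_cond_exp_intg(2)[of e "indicator A"] ieA Aev by (simp add: e_def)
  also have "\<dots> = (\<integral>x. e x \<partial>M)"
    by (intro integral_cong_AE) (use e2 in auto)
  finally have 1: "(\<integral>x. e x * indicator A x \<partial>M) = (\<integral>x. e x \<partial>M)" .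
  have 2: "(\<integral>x. e x * e x \<partial>M) = (\<integral>x. e x \<partial>M)"
    by (intro integral_cong_AE) (use e2 in auto)
  have 3: "(\<integral>x. indicator A x \<partial>M) = (\<integral>x. e x \<partial>M)"
    unfolding e_def by (rule H.real_cond_exp_int(2)[OF int1, symmetric])
  have sq: "(\<lambda>x. (indicator A x - e x)\<^sup>2) = (\<lambda>x. indicator A x - 2 * (e x * indicator A x) + e x * e x)"
    by (auto simp: power2_eq_square indicator_def algebra_simps)
  \<comment> \<open>The four moments coincide: 1_A, e, e 1_A and e^2 have the same mean, so the mean
    square distance of 1_A and e is zero and \<open>A\<close> itself agrees almost surely with the
    event e = 1.\<close>
  have "(\<integral>x. (indicator A x - e x)\<^sup>2 \<partial>M) = 0"
    unfolding sq using int1 ieA iee 1 2 3 by simp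
  moreover have "integrable M (\<lambda>x. (indicator A x - e x)\<^sup>2)"
    unfolding sq using int1 ieA iee by simp
  ultimately have "AE x in M. (indicator A x - e x)\<^sup>2 = 0"
    by (subst (asm) integral_nonneg_eq_0_iff_AE) auto
  then have "AE x in M. x \<in> A \<longleftrightarrow> x \<in> {x \<in> space H. e x = 1}"
    using AE_space H by (auto elim!: eventually_mono simp: subalgebra_def indicator_def split: if_splits)
  moreover have "{x \<in> space H. e x = 1} \<in> sets H" by measurable
  ultimately show thesis using that by blast
qed

section \<open>Approximation by an algebra\<close>

lemma sets_generated_sigma_finite:
  "sets (generated_sigma \<Omega> X T) =
     sigma_sets \<Omega> (\<Union>J\<in>{J. finite J \<and> J \<subseteq> T}. sets (generated_sigma \<Omega> X J))"
    (is "_ = sigma_sets \<Omega> ?E")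
proof
  show "sets (generated_sigma \<Omega> X T) \<subseteq> sigma_sets \<Omega> ?E"
    unfolding sets_generated_sigma[of \<Omega> X T]
  proof (rule sigma_sets_mono, safe)
    fix t and S :: "'c set" assume "t \<in> T" "S \<in> sets borel"
    then have "X t -` S \<inter> \<Omega> \<in> sets (generated_sigma \<Omega> X {t})"
      by (auto simp: sets_generated_sigma_singleton)
    then show "X t -` S \<inter> \<Omega> \<in> sigma_sets \<Omega> ?E"
      using \<open>t \<in> T\<close> by (intro sigma_sets.Basic UN_I[of "{t}"]) auto
  qed
  have "?E \<subseteq> sets (generated_sigma \<Omega> X T)"
    using generated_sigma_mono by blast
  then show "sigma_sets \<Omega> ?E \<subseteq> sets (generated_sigma \<Omega> X T)"
    using sets.sigma_sets_subset[of ?E "generated_sigma \<Omega> X T"] by simp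
qed

text \<open>Finite index sets are directed under union, so two finite dimensional events always live
  over a common finite set of indices.\<close>

lemma algebra_generated_sigma_finite:
  "algebra \<Omega> (\<Union>J\<in>{J. finite J \<and> J \<subseteq> T}. sets (generated_sigma \<Omega> X J))" (is "algebra \<Omega> ?E")
  unfolding algebra_iff_Un
proof (intro conjI ballI)
  show "?E \<subseteq> Pow \<Omega>"
    using sets.space_closed[of "generated_sigma \<Omega> X _"] by auto
  show "{} \<in> ?E" by auto
next
  fix a assume "a \<in> ?E"
  then obtain J where "finite J" "J \<subseteq> T" "a \<in> sets (generated_sigma \<Omega> X J)" by auto
  then show "\<Omega> - a \<in> ?E"
    using sets.compl_sets[of a "generated_sigma \<Omega> X J"] by auto
next
  fix a b assume "a \<in> ?E" "b \<in> ?E"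
  then obtain J K where JK: "finite J" "J \<subseteq> T" "a \<in> sets (generated_sigma \<Omega> X J)"
    "finite K" "K \<subseteq> T" "b \<in> sets (generated_sigma \<Omega> X K)" by auto
  then have "a \<in> sets (generated_sigma \<Omega> X (J \<union> K))" "b \<in> sets (generated_sigma \<Omega> X (J \<union> K))"
    using generated_sigma_mono[of J "J \<union> K"] generated_sigma_mono[of K "J \<union> K"] by blast+
  with JK show "a \<union> b \<in> ?E" by (intro UN_I[of "J \<union> K"]) auto
qed

text \<open>A single \<open>B\<close> has to approximate \<open>N\<close> under both measures, so
  the induction runs on their sum \<open>m\<close>.\<close>

lemma finite_measures_algebra_approx:
  assumes "finite_measure \<mu>" "finite_measure \<nu>" and alg: "algebra \<Omega> \<A>"
    and sets: "sets \<mu> = sigma_sets \<Omega> \<A>" "sets \<nu> = sigma_sets \<Omega> \<A>"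
    and N: "N \<in> sigma_sets \<Omega> \<A>" and "e > 0"
  shows "\<exists>B\<in>\<A>. measure \<mu> (sym_diff N B) + measure \<nu> (sym_diff N B) < e"
proof -
  interpret \<mu>: finite_measure \<mu> by fact
  interpret \<nu>: finite_measure \<nu> by fact
  interpret A: algebra \<Omega> \<A> by fact
  define m where "m S = measure \<mu> S + measure \<nu> S" for S
  have AS: "B \<in> sets \<mu>" "B \<in> sets \<nu>" if "B \<in> \<A>" for B
    using that sets by auto
  have mono: "m S \<le> m S'" if "S \<subseteq> S'" "S' \<in> sigma_sets \<Omega> \<A>" for S S'
    unfolding m_def using that sets by (intro add_mono \<mu>.finite_measure_mono \<nu>.finite_measure_mono) auto
  have subadd: "m (S \<union> S') \<le> m S + m S'" if "S \<in> sigma_sets \<Omega> \<A>" "S' \<in> sigma_sets \<Omega> \<A>" for S S'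
    using that sets measure_Un_le[of S \<mu> S'] measure_Un_le[of S \<nu> S']
    by (simp add: m_def)
  have Int_st: "Int_stable \<A>" by (auto simp: Int_stable_def)
  have "\<exists>B\<in>\<A>. m (sym_diff N B) < e" using Int_st A.space_closed N \<open>e > 0\<close>
  proof (induct arbitrary: e rule: sigma_sets_induct_disjoint)
    case (basic S)
    then show ?case by (intro bexI[of _ S]) (auto simp: m_def)
  next
    case empty
    then show ?case by (intro bexI[of _ "{}"]) (auto simp: m_def)
  next
    case (compl S)
    then obtain B where B: "B \<in> \<A>" "m (sym_diff S B) < e" by blast
    have "S \<subseteq> \<Omega>" using compl(1) A.space_closed sigma_sets_into_sp by metis
    moreover have "B \<subseteq> \<Omega>" using B A.space_closed by auto
    ultimately have "sym_diff (\<Omega> - S) (\<Omega> - B) = sym_diff S B" by auto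
    then show ?case using B by (intro bexI[of _ "\<Omega> - B"]) auto
  next
    case (union S)
    have Sm: "S i \<in> sigma_sets \<Omega> \<A>" for i using union by auto
    have S: "range S \<subseteq> sets \<mu>" "range S \<subseteq> sets \<nu>" using union sets by auto
    have lim: "(\<lambda>n. \<Sum>i<n. m (S i)) \<longlonglongrightarrow> m (\<Union>i. S i)"
      using sums_add[OF \<mu>.finite_measure_UNION[OF S(1) union(1)] \<nu>.finite_measure_UNION[OF S(2) union(1)]]
      by (simp add: m_def sums_def)
    then have "\<forall>\<^sub>F n in sequentially. m (\<Union>i. S i) - e / 2 < (\<Sum>i<n. m (S i))"
      using \<open>e > 0\<close> by (intro order_tendstoD(1)[OF lim]) auto
    then obtain n where n: "m (\<Union>i. S i) - e / 2 < (\<Sum>i<n. m (S i))"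
      by (auto simp: eventually_sequentially)
    define U where "U = (\<Union>i<n. S i)"
    have U: "U \<in> sets \<mu>" "U \<in> sets \<nu>" "U \<subseteq> (\<Union>i. S i)" using S by (auto simp: U_def)
    have "(\<Sum>i<n. measure \<mu> (S i)) = measure \<mu> U"
      unfolding U_def using S union(1)
      by (intro \<mu>.finite_measure_finite_Union[symmetric]) (auto simp: disjoint_family_on_def)
    moreover have "(\<Sum>i<n. measure \<nu> (S i)) = measure \<nu> U"
      unfolding U_def using S union(1)
      by (intro \<nu>.finite_measure_finite_Union[symmetric]) (auto simp: disjoint_family_on_def)
    ultimately have "(\<Sum>i<n. m (S i)) = m U"
      unfolding m_def sum.distrib by simp
    moreover have "m ((\<Union>i. S i) - U) = m (\<Union>i. S i) - m U"
      unfolding m_def using U S \<mu>.finite_measure_Diff[of "\<Union>i. S i" U] \<nu>.finite_measure_Diff[of "\<Union>i. S i" U]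
      by auto
    ultimately have tail: "m ((\<Union>i. S i) - U) < e / 2" using n by simp
    \<comment> \<open>The tail beyond \<open>n\<close> uses up e/2; the other half is shared among
      the first \<open>n\<close> sets. The summand 1 keeps the denominator positive when
      \<open>n = 0\<close>.\<close>
    have "\<forall>i. \<exists>B\<in>\<A>. m (sym_diff (S i) B) < e / (2 * (real n + 1))"
      using union(3)[of "e / (2 * (real n + 1))"] \<open>e > 0\<close> by simp
    then obtain C where C: "\<And>i. C i \<in> \<A>" "\<And>i. m (sym_diff (S i) (C i)) < e / (2 * (real n + 1))"
      by metis
    define D where "D = (\<Union>i<n. C i)"
    have D: "D \<in> \<A>" unfolding D_def using C by auto
    have sd: "sym_diff (S i) (C i) \<in> sigma_sets \<Omega> \<A>" for i
      using Sm[of i] C(1)[of i] sets AS unfolding sets(1)[symmetric] by (intro sets.Un sets.Diff) auto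
    have sdU: "(\<Union>i<k. sym_diff (S i) (C i)) \<in> sigma_sets \<Omega> \<A>" for k
      using sd unfolding sets(1)[symmetric] by (intro sets.finite_UN finite_lessThan)
    have "m (\<Union>i<k. sym_diff (S i) (C i)) \<le> real k * (e / (2 * (real n + 1)))" for k
    proof (induct k)
      case 0 then show ?case by (simp add: m_def)
    next
      case (Suc k)
      have "m (\<Union>i<Suc k. sym_diff (S i) (C i)) \<le> m (sym_diff (S k) (C k)) + m (\<Union>i<k. sym_diff (S i) (C i))"
        unfolding lessThan_Suc UN_insert by (intro subadd sd sdU)
      also have "\<dots> \<le> real (Suc k) * (e / (2 * (real n + 1)))"
        using Suc C(2)[of k] unfolding of_nat_Suc distrib_right by linarith
      finally show ?case .
    qed
    then have "m (\<Union>i<n. sym_diff (S i) (C i)) \<le> real n * (e / (2 * (real n + 1)))" .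
    also have "\<dots> \<le> e / 2" using \<open>e > 0\<close> by (simp add: field_simps)
    finally have fin: "m (\<Union>i<n. sym_diff (S i) (C i)) \<le> e / 2" .
    have m1: "(\<Union>i. S i) - U \<in> sigma_sets \<Omega> \<A>"
      using U S unfolding sets(1)[symmetric] by auto
    have "sym_diff (\<Union>i. S i) D \<subseteq> ((\<Union>i. S i) - U) \<union> (\<Union>i<n. sym_diff (S i) (C i))"
      by (auto simp: D_def U_def)
    then have "m (sym_diff (\<Union>i. S i) D) \<le> m (((\<Union>i. S i) - U) \<union> (\<Union>i<n. sym_diff (S i) (C i)))"
      using m1 sdU[of n] unfolding sets(1)[symmetric] by (intro mono) (auto simp only: sets(1)[symmetric] intro: sets.Un)
    also have "\<dots> \<le> m ((\<Union>i. S i) - U) + m (\<Union>i<n. sym_diff (S i) (C i))"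
      by (intro subadd m1 sdU)
    also have "\<dots> < e" using tail fin by simp
    finally show ?case using D by blast
  qed
  then show ?thesis by (simp add: m_def)
qed

text \<open>The bound is what a density with second moment \<open>K\<close> gives after truncation
  at \<open>T\<close>. Approximating a \<nu>-null set within \<open>d\<close> by a member of the
  algebra gives \<mu>-measure at most (T + 1) d + K / T.\<close>

lemma null_sets_transfer_algebra:
  fixes K :: real
  assumes "finite_measure \<mu>" "finite_measure \<nu>" and alg: "algebra \<Omega> \<A>"
    and sets: "sets \<mu> = sigma_sets \<Omega> \<A>" "sets \<nu> = sigma_sets \<Omega> \<A>" and "0 < K"
    and bound: "\<And>B T. B \<in> \<A> \<Longrightarrow> T > 0 \<Longrightarrow> measure \<mu> B \<le> T * measure \<nu> B + K / T"
    and N: "N \<in> null_sets \<nu>"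
  shows "N \<in> null_sets \<mu>"
proof -
  interpret \<mu>: finite_measure \<mu> by fact
  interpret \<nu>: finite_measure \<nu> by fact
  have Ns: "N \<in> sigma_sets \<Omega> \<A>" "measure \<nu> N = 0"
    using N sets by (auto simp: null_sets_def measure_def)
  have "measure \<mu> N \<le> e" if "e > 0" for e
  proof -
    \<comment> \<open>\<open>T\<close> is fixed first and makes K / T equal to e/3; \<open>d\<close>
      then depends on \<open>T\<close> and makes (T + 1) d equal to e/3.\<close>
    define T where "T = 3 * K / e"
    define d where "d = e / (3 * (T + 1))"
    have "T > 0" "d > 0" using \<open>e > 0\<close> \<open>0 < K\<close> by (auto simp: T_def d_def add_pos_pos)
    obtain B where B: "B \<in> \<A>" "measure \<mu> (sym_diff N B) + measure \<nu> (sym_diff N B) < d"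
      using finite_measures_algebra_approx[OF assms(1,2) alg sets Ns(1) \<open>d > 0\<close>] by auto
    have ms: "N \<in> sets \<mu>" "B \<in> sets \<mu>" "N \<in> sets \<nu>" "B \<in> sets \<nu>" using sets Ns B by auto
    have d: "measure \<mu> (sym_diff N B) < d" "measure \<nu> (sym_diff N B) < d"
      using B(2) measure_nonneg[of \<mu> "sym_diff N B"] measure_nonneg[of \<nu> "sym_diff N B"] by linarith+
    have "measure \<nu> B \<le> measure \<nu> (N \<union> sym_diff N B)"
      using ms by (intro \<nu>.finite_measure_mono) auto
    also have "\<dots> \<le> measure \<nu> N + measure \<nu> (sym_diff N B)"
      using ms by (intro measure_Un_le) auto
    finally have \<nu>B: "measure \<nu> B \<le> d" using Ns d by simp
    have "measure \<mu> N \<le> measure \<mu> (B \<union> sym_diff N B)"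
      using ms by (intro \<mu>.finite_measure_mono) auto
    also have "\<dots> \<le> measure \<mu> B + measure \<mu> (sym_diff N B)"
      using ms by (intro measure_Un_le) auto
    also have "\<dots> \<le> (T * d + K / T) + d"
      using bound[OF B(1) \<open>T > 0\<close>] d \<nu>B mult_left_mono[OF \<nu>B, of T] \<open>T > 0\<close> by linarith
    also have "\<dots> = (T + 1) * d + K / T" by (simp add: algebra_simps)
    also have "(T + 1) * d = e / 3" using \<open>T > 0\<close> by (simp add: d_def divide_simps) 
    also have "K / T = e / 3" using \<open>e > 0\<close> \<open>0 < K\<close> by (simp add: T_def)
    finally show ?thesis using \<open>e > 0\<close> by linarith
  qed
  then have "measure \<mu> N \<le> 0" by (rule field_le_epsilon) auto
  then have "measure \<mu> N = 0" using measure_nonneg[of \<mu> N] by linarith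
  then show ?thesis using Ns sets by (auto simp: null_sets_def \<mu>.emeasure_eq_measure)
qed

section \<open>Wiener measure and its translates\<close>

text \<open>The exponential factor is the likelihood ratio of N(a, d) to N(0, d); completing the
  square proves it.\<close>

lemma normal_density_tilt:
  assumes "0 < d"
  shows "normal_density 0 (sqrt d) x * exp (a * x / d - a\<^sup>2 / (2 * d)) = normal_density 0 (sqrt d) (x - a)"
proof -
  have "- x\<^sup>2 / (2 * d) + (a * x / d - a\<^sup>2 / (2 * d)) = - (x - a)\<^sup>2 / (2 * d)"
    using assms by (simp add: field_simps power2_eq_square)
  then have "exp (- x\<^sup>2 / (2 * d)) * exp (a * x / d - a\<^sup>2 / (2 * d)) = exp (- (x - a)\<^sup>2 / (2 * d))"
    by (simp flip: exp_add)
  then show ?thesis using assms by (simp add: normal_density_def)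
qed

text \<open>The squared likelihood ratio shifts the mean by 2a and leaves the constant exp(a^2 / d),
  which is therefore the second moment of the ratio under N(0, d).\<close>

lemma normal_density_tilt_square:
  assumes "0 < d"
  shows "normal_density 0 (sqrt d) x * (exp (a * x / d - a\<^sup>2 / (2 * d)))\<^sup>2 =
    exp (a\<^sup>2 / d) * normal_density 0 (sqrt d) (x - 2 * a)"
proof -
  have "- x\<^sup>2 / (2 * d) + 2 * (a * x / d - a\<^sup>2 / (2 * d)) = a\<^sup>2 / d + - (x - 2 * a)\<^sup>2 / (2 * d)"
    using assms by (simp add: field_simps power2_eq_square)
  then have "exp (- x\<^sup>2 / (2 * d)) * (exp (a * x / d - a\<^sup>2 / (2 * d)))\<^sup>2 =
      exp (a\<^sup>2 / d) * exp (- (x - 2 * a)\<^sup>2 / (2 * d))"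
    by (simp flip: exp_add exp_double)
  then show ?thesis using assms by (simp add: normal_density_def)
qed

context
  fixes M :: "'w measure" and X :: "'w \<Rightarrow> real" and a d :: real and r :: "real \<Rightarrow> real"
  assumes X: "distributed M lborel X (\<lambda>x. ennreal (normal_density 0 (sqrt d) x))" and d: "0 < d"
    and r: "r = (\<lambda>x. exp (a * x / d - a\<^sup>2 / (2 * d)))"
begin

text \<open>Reweighting by \<open>r\<close> turns the law of \<open>X\<close> into that of
  \<open>X + a\<close>: the Cameron-Martin formula for one increment.\<close>

lemma nn_integral_tilt:
  assumes [measurable]: "B \<in> sets borel"
  shows "(\<integral>\<^sup>+\<omega>. ennreal (r (X \<omega>)) * indicator B (X \<omega>) \<partial>M) = emeasure M {\<omega> \<in> space M. X \<omega> + a \<in> B}"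
proof -
  have [measurable]: "X \<in> borel_measurable M" using distributed_measurable[OF X] by simp
  have [measurable]: "r \<in> borel_measurable borel" unfolding r by measurable
  have "(\<integral>\<^sup>+\<omega>. ennreal (r (X \<omega>)) * indicator B (X \<omega>) \<partial>M)
      = (\<integral>\<^sup>+x. ennreal (normal_density 0 (sqrt d) x) * (ennreal (r x) * indicator B x) \<partial>lborel)"
    by (rule distributed_nn_integral[OF X, symmetric]) measurable
  also have "\<dots> = (\<integral>\<^sup>+x. ennreal (normal_density 0 (sqrt d) (x - a)) * indicator B x \<partial>lborel)"
    using normal_density_tilt[OF d]
    by (intro nn_integral_cong) (simp add: r ennreal_mult'[symmetric] flip: mult.assoc)
  also have "\<dots> = (\<integral>\<^sup>+x. ennreal (normal_density 0 (sqrt d) x) * indicator B (x + a) \<partial>lborel)"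
    by (subst nn_integral_real_affine[where c=1 and t=a]) (auto simp: add.commute)
  also have "\<dots> = (\<integral>\<^sup>+\<omega>. indicator B (X \<omega> + a) \<partial>M)"
    by (rule distributed_nn_integral[OF X]) measurable
  also have "\<dots> = (\<integral>\<^sup>+\<omega>. indicator {\<omega> \<in> space M. X \<omega> + a \<in> B} \<omega> \<partial>M)"
    by (intro nn_integral_cong) (auto simp: indicator_def)
  also have "\<dots> = emeasure M {\<omega> \<in> space M. X \<omega> + a \<in> B}" by simp
  finally show ?thesis .
qed

lemma nn_integral_tilt_square:
  "(\<integral>\<^sup>+\<omega>. (ennreal (r (X \<omega>)))\<^sup>2 \<partial>M) = ennreal (exp (a\<^sup>2 / d))"
proof -
  have [measurable]: "r \<in> borel_measurable borel" unfolding r by measurable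
  have "(\<integral>\<^sup>+\<omega>. (ennreal (r (X \<omega>)))\<^sup>2 \<partial>M)
      = (\<integral>\<^sup>+x. ennreal (normal_density 0 (sqrt d) x) * (ennreal (r x))\<^sup>2 \<partial>lborel)"
    by (rule distributed_nn_integral[OF X, symmetric]) measurable
  also have "\<dots> = (\<integral>\<^sup>+x. ennreal (exp (a\<^sup>2 / d)) * ennreal (normal_density 0 (sqrt d) (x - 2 * a)) \<partial>lborel)"
    using normal_density_tilt_square[OF d]
    by (intro nn_integral_cong) (simp add: r ennreal_power ennreal_mult'[symmetric])
  also have "\<dots> = ennreal (exp (a\<^sup>2 / d)) * (\<integral>\<^sup>+x. ennreal (normal_density 0 (sqrt d) (x - 2 * a)) \<partial>lborel)"
    by (intro nn_integral_cmult) measurable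
  also have "(\<integral>\<^sup>+x. ennreal (normal_density 0 (sqrt d) (x - 2 * a)) \<partial>lborel) =
      (\<integral>\<^sup>+x. ennreal (normal_density 0 (sqrt d) x) \<partial>lborel)"
    by (subst nn_integral_real_affine[where c=1 and t="2 * a"]) (auto simp: add.commute)
  also have "\<dots> = 1"
    using d by (subst nn_integral_eq_integral) auto
  finally show ?thesis by simp
qed

end

section \<open>Coordinates and increments of the Wiener process\<close>

text \<open>The function space consists of bounded continuous functions; on the compact interval
  boundedness is automatic.\<close>

lemma space_wiener:
  assumes "wiener_measure P"
  shows "\<omega> \<in> space P \<longleftrightarrow> \<omega> \<in> extensional {0..1} \<and> continuous_on {0..1} \<omega> \<and> \<omega> 0 = 0"
proof -
  have "space P = mspace wiener_paths"
    using assms sets_eq_imp_space_eq[of P wiener_borel]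
    by (simp add: wiener_measure_def wiener_borel_def space_measure_of_conv)
  moreover have "bounded (\<omega> ` {0..1})" if "continuous_on {0..1} \<omega>" for \<omega> :: "real \<Rightarrow> real"
    using that compact_continuous_image compact_imp_bounded by blast
  ultimately show ?thesis
    by (auto simp: wiener_paths_def continuous_map_in_subtopology Met_TC.mbounded_alt bounded_def)
qed

lemma wiener_distributed:
  assumes "wiener_measure P" "0 \<le> s" "s < t" "t \<le> 1"
  shows "distributed P lborel (\<lambda>\<omega>. \<omega> t - \<omega> s) (\<lambda>x. ennreal (normal_density 0 (sqrt (t - s)) x))"
  using assms unfolding wiener_measure_def by blast

text \<open>On the path space a coordinate is the increment from time 0, and
  \<open>distributed\<close> carries the measurability of increments over intervals of positive
  length.\<close>

lemma wiener_measurable: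
  assumes "wiener_measure P" "t \<in> {0..1}"
  shows "(\<lambda>\<omega>. \<omega> t) \<in> borel_measurable P"
proof (cases "t = 0")
  case True
  have "(\<lambda>\<omega>. \<omega> t) \<in> borel_measurable P \<longleftrightarrow> (\<lambda>\<omega>. 0 :: real) \<in> borel_measurable P"
    by (rule measurable_cong) (use True space_wiener[OF assms(1)] in auto)
  then show ?thesis by simp
next
  case False
  then have "(\<lambda>\<omega>. \<omega> t - \<omega> 0) \<in> borel_measurable P"
    using distributed_measurable[OF wiener_distributed[OF assms(1), of 0 t]] assms(2) by simp
  moreover have "(\<lambda>\<omega>. \<omega> t) \<in> borel_measurable P \<longleftrightarrow> (\<lambda>\<omega>. \<omega> t - \<omega> 0) \<in> borel_measurable P"
    by (rule measurable_cong) (use space_wiener[OF assms(1)] in auto)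
  ultimately show ?thesis by simp
qed

text \<open>Time 0 joins the grid so that, paths being 0 there, coordinates at times in
  \<open>J\<close> are partial sums of increments.\<close>

lemma obtain_grid:
  fixes J :: "real set"
  assumes "finite J" "J \<subseteq> {0..1}"
  obtains k u where "u ` {..k::nat} = insert 0 J" "strict_mono_on {..k} u" "u 0 = 0"
proof -
  define S where "S = insert 0 J"
  define k where "k = card S - 1"
  define u where "u i = sorted_list_of_set S ! i" for i
  have S: "finite S" "S \<noteq> {}" using assms by (auto simp: S_def)
  have len: "length (sorted_list_of_set S) = Suc k"
    using S by (simp add: k_def card_gt_0_iff)
  have im: "u ` {..k} = S"
  proof -
    have "S = set (sorted_list_of_set S)" using S by simp
    also have "\<dots> = u ` {..k}" unfolding set_conv_nth len u_def by (auto simp: less_Suc_eq_le)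
    finally show ?thesis by simp
  qed
  have sm: "strict_mono_on {..k} u"
    unfolding strict_mono_on_def u_def using len
    by (auto intro!: sorted_wrt_nth_less[OF strict_sorted_list_of_set])
  have "u 0 = 0"
  proof -
    obtain i where i: "i \<le> k" "u i = 0" using im S_def by (metis imageE insertI1 atMost_iff)
    have "u 0 \<le> u i" using strict_mono_on_leD[OF sm, of 0 i] i by auto
    moreover have "u 0 \<in> S" using im by auto
    ultimately show ?thesis using assms i by (auto simp: S_def)
  qed
  then show thesis using that[of u k] im sm S_def by simp
qed

lemma indep_vars_increments:
  assumes W: "wiener_measure P" and "strict_mono_on {..k} u" "u ` {..k::nat} \<subseteq> {0..1}"
  shows "prob_space.indep_vars P (\<lambda>_. borel) (\<lambda>i \<omega>. \<omega> (u (Suc i)) - \<omega> (u i)) {..<k}"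
  using assms strict_mono_on_imp_mono_on unfolding wiener_measure_def by blast

text \<open>By a pi-system argument finitely many times suffice. The grid contains \<open>p\<close>,
  so no increment straddles it, and the differences with the value at \<open>p\<close> telescope
  into increments from one of two disjoint blocks of an independent family.\<close>

lemma wiener_past_future_indep:
  assumes W: "wiener_measure P" and p: "p \<in> {0..1}"
    and A: "A \<in> sets (generated_sigma (space P) (\<lambda>t \<omega>. \<omega> t - \<omega> p) {0..p})"
    and B: "B \<in> sets (generated_sigma (space P) (\<lambda>t \<omega>. \<omega> t - \<omega> p) {p..1})"
  shows "measure P (A \<inter> B) = measure P A * measure P B"
proof -
  interpret prob_space P using W by (simp add: wiener_measure_def)
  define g where "g = generated_sigma (space P) (\<lambda>t \<omega>. \<omega> t - \<omega> p)"
  define E where "E T = (\<Union>J\<in>{J. finite J \<and> J \<subseteq> T}. sets (g J))" for T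
  have st: "Int_stable (E T)" for T
  proof -
    interpret algebra "space P" "E T"
      unfolding E_def g_def by (rule algebra_generated_sigma_finite)
    show ?thesis by (auto simp: Int_stable_def)
  qed
  have ev: "E T \<subseteq> events" if "T \<subseteq> {0..1}" for T
  proof -
    have "sets (g J) \<subseteq> events" if "J \<subseteq> T" for J
      unfolding g_def using that \<open>T \<subseteq> {0..1}\<close> p
      by (intro sets_generated_sigma_subset) (auto intro!: borel_measurable_diff wiener_measurable[OF W])
    then show ?thesis by (auto simp: E_def)
  qed
  have "indep_set (E {0..p}) (E {p..1})"
    unfolding indep_sets2_eq
  proof (intro conjI ev ballI)
    fix a b assume "a \<in> E {0..p}" "b \<in> E {p..1}"
    then obtain J K where JK: "finite J" "J \<subseteq> {0..p}" "a \<in> sets (g J)" "finite K" "K \<subseteq> {p..1}" "b \<in> sets (g K)"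
      by (auto simp: E_def)
    have "finite (insert p (J \<union> K))" "insert p (J \<union> K) \<subseteq> {0..1}" using JK p by auto
    from obtain_grid[OF this] obtain k u where
      u: "u ` {..k::nat} = insert 0 (insert p (J \<union> K))" "strict_mono_on {..k} u" "u 0 = 0" .
    obtain l where l: "l \<le> k" "u l = p" using u(1) by (metis imageE insertI1 insertI2 atMost_iff)
    define \<Delta> where "\<Delta> i \<omega> = \<omega> (u (Suc i)) - \<omega> (u i)" for i and \<omega> :: "real \<Rightarrow> real"
    have ind: "indep_vars (\<lambda>_. borel) \<Delta> {..<k}"
      unfolding \<Delta>_def by (rule indep_vars_increments[OF W u(2)]) (use u(1) JK p in auto)
    define I where "I j = (if j then {..<l} else {l..<k})" for j
    have tele: "\<omega> (u q) - \<omega> (u q') = (\<Sum>i=q'..<q. \<Delta> i \<omega>)" if "q' \<le> q" for q q' \<omega>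
      unfolding \<Delta>_def using sum_Suc_diff'[OF that, of "\<lambda>i. \<omega> (u i)"] by simp
    have "indep_sets (\<lambda>j. sigma_sets (space P) (\<Union>i\<in>I j. {\<Delta> i -` S \<inter> space P |S. S \<in> sets borel})) UNIV"
    proof (rule indep_sets_collect_sigma)
      have "(\<Union>j\<in>UNIV. I j) = {..<k}" using l by (auto simp: I_def UNIV_bool)
      then show "indep_sets (\<lambda>i. {\<Delta> i -` S \<inter> space P |S. S \<in> sets borel}) (\<Union>j\<in>UNIV. I j)"
        using ind unfolding indep_vars_def2 by simp
      show "disjoint_family_on I UNIV" by (auto simp: disjoint_family_on_def I_def)
      show "Int_stable {\<Delta> i -` S \<inter> space P |S. S \<in> sets borel}" for i
      proof (rule Int_stableI, clarsimp)
        fix S S' :: "real set" assume "S \<in> sets borel" "S' \<in> sets borel"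
        then show "\<exists>S''. \<Delta> i -` S \<inter> space P \<inter> (\<Delta> i -` S' \<inter> space P) = \<Delta> i -` S'' \<inter> space P \<and> S'' \<in> sets borel"
          by (intro exI[of _ "S \<inter> S'"]) auto
      qed
    qed
    moreover have "sigma_sets (space P) (\<Union>i\<in>I j. {\<Delta> i -` S \<inter> space P |S. S \<in> sets borel})
        = sets (generated_sigma (space P) \<Delta> (I j))" for j
      unfolding sets_generated_sigma by (intro arg_cong2[where f=sigma_sets]) auto
    ultimately have "indep_sets (\<lambda>j. sets (generated_sigma (space P) \<Delta> (I j))) UNIV" by simp
    then have "indep_set (sets (generated_sigma (space P) \<Delta> {..<l})) (sets (generated_sigma (space P) \<Delta> {l..<k}))"
      unfolding indep_set_def by (rule indep_sets_mono_sets) (auto simp: I_def split: bool.split)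
    moreover have "sets (g J) \<subseteq> sets (generated_sigma (space P) \<Delta> {..<l})"
      unfolding g_def
    proof (rule sets_generated_sigma_subset)
      fix t assume t: "t \<in> J"
      then obtain q where q: "q \<le> k" "u q = t" using u(1) by (metis imageE insertI2 atMost_iff UnI1)
      have "q \<le> l"
      proof (rule ccontr)
        assume "\<not> q \<le> l"
        then have "u l < u q" using q l by (intro strict_mono_onD[OF u(2)]) auto
        then show False using q l t JK by auto
      qed
      have "\<omega> t - \<omega> p = - (\<Sum>i=q..<l. \<Delta> i \<omega>)" for \<omega>
        using tele[OF \<open>q \<le> l\<close>, of \<omega>] q l by simp
      moreover have "(\<lambda>\<omega>. - (\<Sum>i=q..<l. \<Delta> i \<omega>)) \<in> borel_measurable (generated_sigma (space P) \<Delta> {..<l})"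
        by (intro borel_measurable_uminus borel_measurable_sum measurable_generated_sigma) auto
      ultimately show "(\<lambda>\<omega>. \<omega> t - \<omega> p) \<in> borel_measurable (generated_sigma (space P) \<Delta> {..<l})" by simp
    qed simp
    moreover have "sets (g K) \<subseteq> sets (generated_sigma (space P) \<Delta> {l..<k})"
      unfolding g_def
    proof (rule sets_generated_sigma_subset)
      fix t assume t: "t \<in> K"
      then obtain q where q: "q \<le> k" "u q = t" using u(1) by (metis imageE insertI2 atMost_iff UnI2)
      have "l \<le> q"
      proof (rule ccontr)
        assume "\<not> l \<le> q"
        then have "u q < u l" using q l by (intro strict_mono_onD[OF u(2)]) auto
        then show False using q l t JK by auto
      qed
      have "\<omega> t - \<omega> p = (\<Sum>i=l..<q. \<Delta> i \<omega>)" for \<omega>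
        using tele[OF \<open>l \<le> q\<close>, of \<omega>] q l by simp
      moreover have "(\<lambda>\<omega>. \<Sum>i=l..<q. \<Delta> i \<omega>) \<in> borel_measurable (generated_sigma (space P) \<Delta> {l..<k})"
        using q by (intro borel_measurable_sum measurable_generated_sigma) auto
      ultimately show "(\<lambda>\<omega>. \<omega> t - \<omega> p) \<in> borel_measurable (generated_sigma (space P) \<Delta> {l..<k})" by simp
    qed simp
    ultimately show "prob (a \<inter> b) = prob a * prob b"
      using JK unfolding indep_sets2_eq by blast
  qed (use p in auto)
  then have "indep_set (sigma_sets (space P) (E {0..p})) (sigma_sets (space P) (E {p..1}))"
    by (rule indep_set_sigma_sets[OF _ st st])
  then show ?thesis
    using A B unfolding indep_sets2_eq sets_generated_sigma_finite[of _ _ "{0..p}"]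
      sets_generated_sigma_finite[of _ _ "{p..1}"] E_def g_def by blast
qed

section \<open>Cameron-Martin shifts\<close>

text \<open>The restriction keeps the shifted path extensional, as membership in
  \<open>space P\<close> demands.\<close>

definition path_shift :: "(real \<Rightarrow> real) \<Rightarrow> (real \<Rightarrow> real) \<Rightarrow> real \<Rightarrow> real" where
  "path_shift h \<omega> = (\<lambda>t\<in>{0..1}. \<omega> t + h t)"

lemma path_shift_in_space:
  assumes "wiener_measure P" "continuous_on {0..1} h" "h 0 = 0" "\<omega> \<in> space P"
  shows "path_shift h \<omega> \<in> space P"
proof -
  have "continuous_on {0..1} (path_shift h \<omega>) \<longleftrightarrow> continuous_on {0..1} (\<lambda>t. \<omega> t + h t)"
    by (rule continuous_on_cong) (auto simp: path_shift_def)
  then show ?thesis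
    using assms by (auto simp: space_wiener[OF assms(1)] path_shift_def intro!: continuous_intros)
qed

text \<open>On a grid the shift translates independent normal increments, with density
  \<open>D\<close> a product of likelihood ratios. The point is that neither the second moment bound
  nor the final constant depends on \<open>J\<close>.\<close>

lemma cameron_martin_grid_bound:
  assumes W: "wiener_measure P" and h: "continuous_on {0..1} h" "h 0 = 0"
    and lip: "\<And>s t. s \<in> {0..1} \<Longrightarrow> t \<in> {0..1} \<Longrightarrow> \<bar>h t - h s\<bar> \<le> C * \<bar>t - s\<bar>"
    and J: "finite J" "J \<subseteq> {0..1}"
    and A: "A \<in> sets (generated_sigma (space P) (\<lambda>t \<omega>. \<omega> t) J)" and T: "T > 0"
  shows "measure P (path_shift h -` A \<inter> space P) \<le> T * measure P A + exp (C\<^sup>2) / T"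
proof -
  interpret prob_space P using W by (simp add: wiener_measure_def)
  obtain k u where u: "u ` {..k::nat} = insert 0 J" "strict_mono_on {..k} u" "u 0 = 0"
    using obtain_grid[OF J] .
  have u01: "u i \<in> {0..1}" if "i \<le> k" for i
  proof -
    have "u i \<in> insert 0 J" using u(1) that by blast
    then show ?thesis using J by auto
  qed
  have uless: "u i < u (Suc i)" if "i < k" for i
    using that by (intro strict_mono_onD[OF u(2)]) auto
  define \<Delta> where "\<Delta> i \<omega> = \<omega> (u (Suc i)) - \<omega> (u i)" for i and \<omega> :: "real \<Rightarrow> real"
  define d where "d i = u (Suc i) - u i" for i
  define a where "a i = h (u (Suc i)) - h (u i)" for i
  define r where "r i x = exp (a i * x / d i - (a i)\<^sup>2 / (2 * d i))" for i x
  have d: "0 < d i" if "i < k" for i using uless[OF that] by (simp add: d_def)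
  have ind: "indep_vars (\<lambda>_. borel) \<Delta> {..<k}"
    unfolding \<Delta>_def by (rule indep_vars_increments[OF W u(2)]) (use u(1) J in auto)
  have dist: "distributed P lborel (\<Delta> i) (\<lambda>x. ennreal (normal_density 0 (sqrt (d i)) x))" if "i < k" for i
    unfolding \<Delta>_def d_def using u01[of i] u01[of "Suc i"] uless[OF that] that
    by (intro wiener_distributed[OF W]) auto
  have \<Delta>m: "\<Delta> i \<in> borel_measurable P" if "i < k" for i
    using distributed_measurable[OF dist[OF that]] by simp
  have rm [measurable]: "r i \<in> borel_measurable borel" for i unfolding r_def by measurable
  let ?PM = "PiM {..<k} (\<lambda>_. borel :: real measure)"
  define V where "V \<omega> = (\<lambda>i\<in>{..<k}. \<Delta> i \<omega>)" for \<omega>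
  define V' where "V' \<omega> = (\<lambda>i\<in>{..<k}. \<Delta> i \<omega> + a i)" for \<omega>
  define D where "D \<omega> = (\<Prod>i<k. ennreal (r i (\<Delta> i \<omega>)))" for \<omega>
  have Vm [measurable]: "V \<in> measurable P ?PM" "V' \<in> measurable P ?PM"
    unfolding V_def V'_def using \<Delta>m by (auto intro!: measurable_restrict borel_measurable_add)
  have Dm [measurable]: "D \<in> borel_measurable P"
    unfolding D_def using \<Delta>m by (auto intro!: borel_measurable_prod_ennreal measurable_compose[OF _ measurable_compose[OF rm measurable_ennreal]])
  \<comment> \<open>Rectangles determine the law. On a rectangle independence splits both sides into
    single increments, where the tilting identity applies.\<close>
  have shift_law: "distr (density P D) ?PM V = distr P ?PM V'"
  proof (rule measure_eqI_PiM_finite[symmetric])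
    fix B :: "nat \<Rightarrow> real set" assume B: "\<And>i. i \<in> {..<k} \<Longrightarrow> B i \<in> sets borel"
    have BE: "Pi\<^sub>E {..<k} B \<in> sets ?PM" using B by (intro sets_PiM_I_finite) auto
    have "indep_vars (\<lambda>_. borel) (\<lambda>i. (\<lambda>x. ennreal (r i x) * indicator (B i) x) \<circ> \<Delta> i) {..<k}"
      using B by (intro indep_vars_compose[OF ind] borel_measurable_times_ennreal
          borel_measurable_indicator measurable_compose[OF rm measurable_ennreal])
    then have prod: "(\<integral>\<^sup>+\<omega>. (\<Prod>i<k. ennreal (r i (\<Delta> i \<omega>)) * indicator (B i) (\<Delta> i \<omega>)) \<partial>P)
        = (\<Prod>i<k. \<integral>\<^sup>+\<omega>. ennreal (r i (\<Delta> i \<omega>)) * indicator (B i) (\<Delta> i \<omega>) \<partial>P)"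
      by (subst indep_vars_nn_integral) (auto simp: comp_def)
    have "emeasure (distr (density P D) ?PM V) (Pi\<^sub>E {..<k} B) = (\<integral>\<^sup>+\<omega>. D \<omega> * indicator (Pi\<^sub>E {..<k} B) (V \<omega>) \<partial>P)"
      using BE by (subst emeasure_distr) (auto simp: emeasure_density indicator_def intro!: nn_integral_cong)
    also have "\<dots> = (\<integral>\<^sup>+\<omega>. (\<Prod>i<k. ennreal (r i (\<Delta> i \<omega>)) * indicator (B i) (\<Delta> i \<omega>)) \<partial>P)"
    proof (rule nn_integral_cong)
      fix \<omega>
      have "indicator (Pi\<^sub>E {..<k} B) (V \<omega>) = (\<Prod>i<k. indicator (B i) (\<Delta> i \<omega>) :: ennreal)"
        by (auto simp: indicator_def V_def PiE_iff)
      then show "D \<omega> * indicator (Pi\<^sub>E {..<k} B) (V \<omega>) = (\<Prod>i<k. ennreal (r i (\<Delta> i \<omega>)) * indicator (B i) (\<Delta> i \<omega>))"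
        by (simp add: D_def prod.distrib)
    qed
    also have "\<dots> = (\<Prod>i<k. emeasure P {\<omega> \<in> space P. \<Delta> i \<omega> + a i \<in> B i})"
      unfolding prod
    proof (rule prod.cong)
      fix i assume "i \<in> {..<k}"
      then have i: "i < k" by simp
      show "(\<integral>\<^sup>+\<omega>. ennreal (r i (\<Delta> i \<omega>)) * indicator (B i) (\<Delta> i \<omega>) \<partial>P) =
          emeasure P {\<omega> \<in> space P. \<Delta> i \<omega> + a i \<in> B i}"
        by (rule nn_integral_tilt[OF dist[OF i] d[OF i], where r="r i"]) (use B i in \<open>auto simp: r_def\<close>)
    qed simp
    also have "\<dots> = emeasure P {\<omega> \<in> space P. \<forall>i<k. \<Delta> i \<omega> + a i \<in> B i}"
    \<comment> \<open>\<open>k = 0\<close> occurs when \<open>J\<close> contains at most the time 0;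
      the empty product is then the total mass 1.\<close>
    proof (cases "k = 0")
      case True then show ?thesis by (simp add: emeasure_space_1)
    next
      case False
      have "indep_vars (\<lambda>_. borel) (\<lambda>i. (\<lambda>x. x + a i) \<circ> \<Delta> i) {..<k}"
        by (intro indep_vars_compose[OF ind]) measurable
      from indep_varsD_finite[OF this, of B] False B
      have "prob (\<Inter>i<k. ((\<lambda>x. x + a i) \<circ> \<Delta> i) -` B i \<inter> space P) =
          (\<Prod>i<k. prob (((\<lambda>x. x + a i) \<circ> \<Delta> i) -` B i \<inter> space P))" by auto
      moreover have "(\<Inter>i<k. ((\<lambda>x. x + a i) \<circ> \<Delta> i) -` B i \<inter> space P) = {\<omega> \<in> space P. \<forall>i<k. \<Delta> i \<omega> + a i \<in> B i}"
        using False by auto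
      moreover have "((\<lambda>x. x + a i) \<circ> \<Delta> i) -` B i \<inter> space P = {\<omega> \<in> space P. \<Delta> i \<omega> + a i \<in> B i}" for i
        by auto
      ultimately show ?thesis by (simp add: emeasure_eq_measure prod_ennreal)
    qed
    finally have law: "emeasure (distr (density P D) ?PM V) (Pi\<^sub>E {..<k} B) =
      emeasure P {\<omega> \<in> space P. \<forall>i<k. \<Delta> i \<omega> + a i \<in> B i}" .
    have "emeasure (distr P ?PM V') (Pi\<^sub>E {..<k} B) = emeasure P {\<omega> \<in> space P. \<forall>i<k. \<Delta> i \<omega> + a i \<in> B i}"
    proof -
      have "V' -` Pi\<^sub>E {..<k} B \<inter> space P = {\<omega> \<in> space P. \<forall>i<k. \<Delta> i \<omega> + a i \<in> B i}"
        unfolding V'_def set_eq_iff by (simp add: PiE_iff conj_commute Ball_def)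
      then show ?thesis by (simp add: emeasure_distr[OF Vm(2) BE])
    qed
    with law show "emeasure (distr P ?PM V') (Pi\<^sub>E {..<k} B) = emeasure (distr (density P D) ?PM V) (Pi\<^sub>E {..<k} B)"
      by (rule trans[OF _ sym, rotated])
  next
    show "range (\<lambda>_::nat. space ?PM) \<subseteq> prod_algebra {..<k} (\<lambda>_. borel :: real measure)"
      using prod_algebraI_finite[of "{..<k}" "\<lambda>_. UNIV" "\<lambda>_. borel :: real measure"] by (auto simp: space_PiM)
    show "emeasure (distr P ?PM V') (space ?PM) \<noteq> \<infinity>" for i :: nat
      by (simp add: emeasure_distr emeasure_eq_measure)
  qed auto
  have nnD2: "(\<integral>\<^sup>+\<omega>. (D \<omega>)\<^sup>2 \<partial>P) \<le> ennreal (exp (C\<^sup>2))"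
  proof -
    have "indep_vars (\<lambda>_. borel) (\<lambda>i. (\<lambda>x. (ennreal (r i x))\<^sup>2) \<circ> \<Delta> i) {..<k}"
      by (intro indep_vars_compose[OF ind]) measurable
    then have "(\<integral>\<^sup>+\<omega>. (\<Prod>i<k. (ennreal (r i (\<Delta> i \<omega>)))\<^sup>2) \<partial>P) = (\<Prod>i<k. \<integral>\<^sup>+\<omega>. (ennreal (r i (\<Delta> i \<omega>)))\<^sup>2 \<partial>P)"
      by (subst indep_vars_nn_integral) (auto simp: comp_def)
    also have "\<dots> = (\<Prod>i<k. ennreal (exp ((a i)\<^sup>2 / d i)))"
    proof (rule prod.cong)
      fix i assume "i \<in> {..<k}"
      then have i: "i < k" by simp
      show "(\<integral>\<^sup>+\<omega>. (ennreal (r i (\<Delta> i \<omega>)))\<^sup>2 \<partial>P) = ennreal (exp ((a i)\<^sup>2 / d i))"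
        by (rule nn_integral_tilt_square[OF dist[OF i] d[OF i], where r="r i"]) (auto simp: r_def)
    qed simp
    also have "\<dots> = ennreal (exp (\<Sum>i<k. (a i)\<^sup>2 / d i))"
      by (simp add: prod_ennreal exp_sum)
    also have "\<dots> \<le> ennreal (exp (C\<^sup>2))"
    proof -
      \<comment> \<open>The Lipschitz bound gives a_i^2 / d_i at most C^2 d_i, and the grid lengths
        d_i add up to at most 1 for every grid.\<close>
      have "(\<Sum>i<k. (a i)\<^sup>2 / d i) \<le> (\<Sum>i<k. C\<^sup>2 * d i)"
      proof (rule sum_mono)
        fix i assume "i \<in> {..<k}"
        then have i: "i < k" by simp
        have "\<bar>a i\<bar> \<le> C * d i"
          using lip[of "u i" "u (Suc i)"] u01[of i] u01[of "Suc i"] i d[OF i] by (simp add: a_def d_def)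
        then have "\<bar>a i\<bar>\<^sup>2 \<le> (C * d i)\<^sup>2" by (intro power_mono) auto
        then show "(a i)\<^sup>2 / d i \<le> C\<^sup>2 * d i"
          using d[OF i] by (simp add: divide_le_eq power2_eq_square mult_ac)
      qed
      also have "\<dots> = C\<^sup>2 * (u k - u 0)"
        by (simp add: d_def sum_lessThan_telescope flip: sum_distrib_left)
      also have "\<dots> \<le> C\<^sup>2 * 1"
        using u01[of k] u(3) by (intro mult_left_mono) auto
      finally show ?thesis by (simp add: ennreal_leI)
    qed
    finally show ?thesis by (simp add: D_def prod_power_distrib)
  qed
  \<comment> \<open>Coordinates at times in \<open>J\<close> are sums of entries of the increment
    vector \<open>V\<close>, so \<open>A\<close> is the preimage under \<open>V\<close> of some
    measurable \<open>E\<close>, and \<open>shift_law\<close> applies to \<open>A\<close>.\<close>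
  have "sets (generated_sigma (space P) (\<lambda>t \<omega>. \<omega> t) J) \<subseteq> sets (vimage_algebra (space P) V ?PM)"
  proof (rule sets_generated_sigma_subset)
    fix t assume "t \<in> J"
    then obtain q where q: "q \<le> k" "u q = t" using u(1) by (metis imageE insertI2 atMost_iff)
    have m: "(\<lambda>\<omega>. \<Sum>i<q. V \<omega> i) \<in> borel_measurable (vimage_algebra (space P) V ?PM)"
    proof (rule borel_measurable_sum)
      fix i assume "i \<in> {..<q}"
      have "V \<in> measurable (vimage_algebra (space P) V ?PM) ?PM"
        using Vm(1)[THEN measurable_space] by (intro measurable_vimage_algebra1) auto
      moreover have "(\<lambda>x. x i) \<in> measurable ?PM borel"
        using \<open>i \<in> {..<q}\<close> q by (intro measurable_component_singleton[where M="\<lambda>_. borel"]) auto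
      ultimately show "(\<lambda>\<omega>. V \<omega> i) \<in> borel_measurable (vimage_algebra (space P) V ?PM)"
        by (rule measurable_compose)
    qed
    have "\<omega> t = (\<Sum>i<q. V \<omega> i)" if "\<omega> \<in> space P" for \<omega>
    proof -
      have "(\<Sum>i<q. V \<omega> i) = (\<Sum>i<q. \<Delta> i \<omega>)" using q by (intro sum.cong) (auto simp: V_def)
      also have "\<dots> = \<omega> (u q) - \<omega> (u 0)" using sum_lessThan_telescope[of "\<lambda>i. \<omega> (u i)" q] by (simp add: \<Delta>_def)
      finally show ?thesis using that u(3) q(2) by (simp add: space_wiener[OF W])
    qed
    then have "(\<lambda>\<omega>. \<omega> t) \<in> borel_measurable (vimage_algebra (space P) V ?PM) \<longleftrightarrow>
        (\<lambda>\<omega>. \<Sum>i<q. V \<omega> i) \<in> borel_measurable (vimage_algebra (space P) V ?PM)"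
      by (intro measurable_cong) simp
    then show "(\<lambda>\<omega>. \<omega> t) \<in> borel_measurable (vimage_algebra (space P) V ?PM)" using m by simp
  qed simp
  then have "A \<in> {V -` S \<inter> space P |S. S \<in> sets ?PM}"
    using A sets_vimage_algebra2[of V "space P" ?PM] Vm(1)[THEN measurable_space] by auto
  then obtain E where E: "E \<in> sets ?PM" "A = V -` E \<inter> space P" by auto
  have Aev: "A \<in> events" unfolding E(2) using E(1) by measurable
  have VV': "V (path_shift h \<omega>) = V' \<omega>" for \<omega>
    using u01 by (auto simp: V_def V'_def \<Delta>_def a_def path_shift_def fun_eq_iff)
  have "path_shift h -` A \<inter> space P = V' -` E \<inter> space P"
    using path_shift_in_space[OF W h] VV' by (auto simp: E(2))
  then have "emeasure P (path_shift h -` A \<inter> space P) = emeasure (distr (density P D) ?PM V) E"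
    unfolding shift_law using E(1) by (simp add: emeasure_distr)
  also have "\<dots> = (\<integral>\<^sup>+\<omega>. D \<omega> * indicator A \<omega> \<partial>P)"
    using E by (subst emeasure_distr) (auto simp: emeasure_density)
  also have "\<dots> \<le> (\<integral>\<^sup>+\<omega>. ennreal T * indicator A \<omega> + ennreal (1 / T) * (D \<omega>)\<^sup>2 \<partial>P)"
  proof (rule nn_integral_mono)
    fix \<omega>
    define x where "x = (\<Prod>i<k. r i (\<Delta> i \<omega>))"
    have x: "D \<omega> = ennreal x" "0 \<le> x"
      by (auto simp: x_def D_def r_def prod_ennreal intro!: prod_nonneg)
    \<comment> \<open>Truncation: either x is at most T, or x is at most x^2 / T. This trades the
      density for its second moment.\<close>
    have "x \<le> T + 1 / T * x\<^sup>2"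
    proof (cases "x \<le> T")
      case True
      have "0 \<le> 1 / T * x\<^sup>2" using T by simp
      with True show ?thesis by linarith
    next
      case False
      then have "x * T \<le> x * x" using x by (intro mult_left_mono) auto
      then have "x \<le> 1 / T * x\<^sup>2" using T by (simp add: field_simps power2_eq_square)
      with T show ?thesis by linarith
    qed
    then have "ennreal x \<le> ennreal T + ennreal (1 / T) * (ennreal x)\<^sup>2"
      using T x(2) by (simp add: ennreal_power ennreal_leI flip: ennreal_mult' ennreal_plus)
    then show "D \<omega> * indicator A \<omega> \<le> ennreal T * indicator A \<omega> + ennreal (1 / T) * (D \<omega>)\<^sup>2"
      by (auto simp: indicator_def x(1))
  qed
  also have "\<dots> = ennreal T * emeasure P A + ennreal (1 / T) * (\<integral>\<^sup>+\<omega>. (D \<omega>)\<^sup>2 \<partial>P)"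
    using Aev by (subst nn_integral_add) (auto simp: nn_integral_cmult)
  also have "\<dots> \<le> ennreal T * emeasure P A + ennreal (1 / T) * ennreal (exp (C\<^sup>2))"
    using nnD2 by (intro add_mono mult_left_mono) auto
  also have "\<dots> = ennreal (T * measure P A + exp (C\<^sup>2) / T)"
    using T by (simp add: emeasure_eq_measure flip: ennreal_mult' ennreal_plus)
  finally show ?thesis
    unfolding emeasure_eq_measure by (rule ennreal_le_iff[THEN iffD1, rotated]) (use T in simp)
qed

text \<open>The law of the shifted path and \<open>P\<close> itself are compared on the coordinate
  sigma-field, where finite dimensional events are a generating algebra and the grid bound has one
  constant exp(C^2) for all of them.\<close>

lemma cameron_martin_null_sets:
  assumes W: "wiener_measure P" and h0: "h 0 = 0"
    and lip: "\<And>s t. s \<in> {0..1} \<Longrightarrow> t \<in> {0..1} \<Longrightarrow> \<bar>h t - h s\<bar> \<le> C * \<bar>t - s\<bar>"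
    and N: "N \<in> sets (generated_sigma (space P) (\<lambda>t \<omega>. \<omega> t) {0..1})" "measure P N = 0"
  shows "AE \<omega> in P. path_shift h \<omega> \<notin> N"
proof -
  interpret prob_space P using W by (simp add: wiener_measure_def)
  define g where "g = generated_sigma (space P) (\<lambda>t \<omega>. \<omega> t :: real)"
  define \<A> where "\<A> = (\<Union>J\<in>{J. finite J \<and> J \<subseteq> {0..1}}. sets (g J))"
  have h: "continuous_on {0..1} h"
  proof (rule continuous_on_subset[OF lipschitz_on_continuous_on[of "\<bar>C\<bar>"]])
    show "\<bar>C\<bar>-lipschitz_on {0..1} h"
    proof (rule lipschitz_onI)
      fix x y :: real assume "x \<in> {0..1}" "y \<in> {0..1}"
      then have "\<bar>h x - h y\<bar> \<le> C * \<bar>x - y\<bar>" using lip by simp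
      also have "\<dots> \<le> \<bar>C\<bar> * \<bar>x - y\<bar>" by (intro mult_right_mono) auto
      finally show "dist (h x) (h y) \<le> \<bar>C\<bar> * dist x y" by (simp add: dist_real_def)
    qed simp
  qed simp
  have subalg: "subalgebra P (g {0..1})"
    unfolding g_def by (intro subalgebra_generated_sigma wiener_measurable[OF W]) auto
  have sets_g: "sets (g {0..1}) = sigma_sets (space P) \<A>"
    unfolding g_def \<A>_def by (rule sets_generated_sigma_finite)
  have alg: "algebra (space P) \<A>"
    unfolding g_def \<A>_def by (rule algebra_generated_sigma_finite)
  have sm: "path_shift h \<in> measurable P (g {0..1})"
    unfolding g_def generated_sigma_def
  proof (rule measurable_measure_of)
    show "path_shift h \<in> space P \<rightarrow> space P" using path_shift_in_space[OF W h h0] by auto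
    fix y assume "y \<in> {(\<lambda>\<omega>. \<omega> t) -` S \<inter> space P |t S. t \<in> {0..1::real} \<and> S \<in> sets (borel :: real measure)}"
    then obtain t S where y: "y = (\<lambda>\<omega>. \<omega> t) -` S \<inter> space P" "t \<in> {0..1}" "S \<in> sets borel" by auto
    have "path_shift h -` y \<inter> space P = (\<lambda>\<omega>. \<omega> t + h t) -` S \<inter> space P"
      using y path_shift_in_space[OF W h h0] by (auto simp: path_shift_def)
    also have "\<dots> \<in> events"
      using wiener_measurable[OF W y(2)] y(3) by (intro measurable_sets[of _ _ borel]) auto
    finally show "path_shift h -` y \<inter> space P \<in> events" .
  qed auto
  let ?\<mu> = "distr P (g {0..1}) (path_shift h)" and ?\<nu> = "restr_to_subalg P (g {0..1})"
  have "N \<in> null_sets ?\<mu>"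
  proof (rule null_sets_transfer_algebra[of ?\<mu> ?\<nu> "space P" \<A> "exp (C\<^sup>2)"])
    show "finite_measure ?\<mu>" using sm by (rule finite_measure_distr)
    show "finite_measure ?\<nu>" by (rule finite_measure_restr_to_subalg[OF subalg]) unfold_locales
    show "sets ?\<mu> = sigma_sets (space P) \<A>" "sets ?\<nu> = sigma_sets (space P) \<A>"
      using sets_g sets_restr_to_subalg[OF subalg] by auto
    show "N \<in> null_sets ?\<nu>"
      using N emeasure_restr_to_subalg[OF subalg N(1)[folded g_def]]
      by (auto simp: null_sets_def sets_restr_to_subalg[OF subalg] emeasure_eq_measure simp flip: g_def)
    fix B T assume B: "B \<in> \<A>" and T: "T > (0::real)"
    obtain J where J: "finite J" "J \<subseteq> {0..1}" "B \<in> sets (g J)" using B by (auto simp: \<A>_def)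
    have Bs: "B \<in> sets (g {0..1})" using B sets_g by auto
    show "measure ?\<mu> B \<le> T * measure ?\<nu> B + exp (C\<^sup>2) / T"
      using cameron_martin_grid_bound[OF W h h0 lip J(1,2) J(3)[unfolded g_def] T] Bs sm
      by (simp add: measure_def emeasure_distr[OF sm Bs] emeasure_restr_to_subalg[OF subalg Bs])
  qed (use alg in auto)
  then have "AE \<omega> in ?\<mu>. \<omega> \<notin> N" by (rule AE_not_in)
  then show ?thesis by (rule AE_distrD[OF sm])
qed

section \<open>Linear integral equations\<close>

text \<open>Continuity in time makes the integrand a limit of functions piecewise constant in time,
  hence jointly measurable, and integrating out the time preserves measurability.\<close>

lemma borel_measurable_integral_continuous:
  fixes f :: "real \<Rightarrow> 'w \<Rightarrow> 'b::euclidean_space"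
  assumes meas: "\<And>s. s \<in> {a..b} \<Longrightarrow> f s \<in> borel_measurable M"
    and cont: "\<And>\<omega>. \<omega> \<in> space M \<Longrightarrow> continuous_on {a..b} (\<lambda>s. f s \<omega>)"
  shows "(\<lambda>\<omega>. integral {a..b} (\<lambda>s. f s \<omega>)) \<in> borel_measurable M"
proof (cases "a \<le> b")
  case False
  then show ?thesis by simp
next
  case True
  \<comment> \<open>Grid of mesh 1/(m+1), clipped to \<open>{a..b}\<close> because \<open>f\<close>
    is controlled only there.\<close>
  define c where "c m i = max a (min b (of_int i / (real m + 1)))" for m :: nat and i :: int
  have c: "c m i \<in> {a..b}" for m i using True by (auto simp: c_def)
  have lim: "(\<lambda>m. c m \<lfloor>s * (real m + 1)\<rfloor>) \<longlonglongrightarrow> s" if "s \<in> {a..b}" for s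
  proof -
    have "(\<lambda>m. of_int \<lfloor>s * (real m + 1)\<rfloor> / (real m + 1)) \<longlonglongrightarrow> s"
    proof (rule tendsto_sandwich)
      show "\<forall>\<^sub>F m in sequentially. s - 1 / (real m + 1) \<le> of_int \<lfloor>s * (real m + 1)\<rfloor> / (real m + 1)"
      proof (rule always_eventually, safe)
        fix m :: nat
        have "s * (real m + 1) - 1 \<le> of_int \<lfloor>s * (real m + 1)\<rfloor>" by linarith
        then have "(s * (real m + 1) - 1) / (real m + 1) \<le> of_int \<lfloor>s * (real m + 1)\<rfloor> / (real m + 1)"
          by (intro divide_right_mono) auto
        then show "s - 1 / (real m + 1) \<le> of_int \<lfloor>s * (real m + 1)\<rfloor> / (real m + 1)"
          by (simp add: diff_divide_distrib)
      qed
      show "\<forall>\<^sub>F m in sequentially. of_int \<lfloor>s * (real m + 1)\<rfloor> / (real m + 1) \<le> s"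
        by (intro always_eventually allI) (simp add: divide_le_eq)
      show "(\<lambda>m. s - 1 / (real m + 1)) \<longlonglongrightarrow> s"
        using tendsto_diff[OF tendsto_const[of s] LIMSEQ_inverse_real_of_nat]
        by (simp add: inverse_eq_divide add.commute)
    qed simp
    then have "(\<lambda>m. c m \<lfloor>s * (real m + 1)\<rfloor>) \<longlonglongrightarrow> max a (min b s)"
      unfolding c_def by (intro tendsto_max tendsto_min tendsto_const)
    then show ?thesis using that by simp
  qed
  define F where "F x = indicator {a..b} (snd x) *\<^sub>R f (snd x) (fst x)" for x :: "'w \<times> real"
  have "F \<in> borel_measurable (M \<Otimes>\<^sub>M (lborel :: real measure))"
  proof (rule borel_measurable_LIMSEQ_metric)
    fix m
    have "(\<lambda>x. f (c m i) (fst x)) \<in> borel_measurable (M \<Otimes>\<^sub>M (lborel :: real measure))" for i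
      by (rule measurable_compose[OF measurable_fst meas[OF c]])
    moreover have "(\<lambda>x. \<lfloor>snd x * (real m + 1)\<rfloor>) \<in> measurable (M \<Otimes>\<^sub>M (lborel :: real measure)) (count_space UNIV)"
      by measurable
    ultimately have "(\<lambda>x. f (c m \<lfloor>snd x * (real m + 1)\<rfloor>) (fst x)) \<in> borel_measurable (M \<Otimes>\<^sub>M (lborel :: real measure))"
      by (rule measurable_compose_countable)
    then show "(\<lambda>x. indicator {a..b} (snd x) *\<^sub>R f (c m \<lfloor>snd x * (real m + 1)\<rfloor>) (fst x))
        \<in> borel_measurable (M \<Otimes>\<^sub>M (lborel :: real measure))" by measurable
  next
    fix x assume "x \<in> space (M \<Otimes>\<^sub>M (lborel :: real measure))"
    then have x: "fst x \<in> space M" by (auto simp: space_pair_measure)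
    show "(\<lambda>m. indicator {a..b} (snd x) *\<^sub>R f (c m \<lfloor>snd x * (real m + 1)\<rfloor>) (fst x)) \<longlonglongrightarrow> F x"
    proof (cases "snd x \<in> {a..b}")
      case True
      have "(\<lambda>m. f (c m \<lfloor>snd x * (real m + 1)\<rfloor>) (fst x)) \<longlonglongrightarrow> f (snd x) (fst x)"
        by (rule continuous_on_tendsto_compose[OF cont[OF x] lim[OF True] True]) (use c in auto)
      then show ?thesis using True by (simp add: F_def)
    qed (simp add: F_def)
  qed
  then have "(\<lambda>\<omega>. \<integral>s. F (\<omega>, s) \<partial>lborel) \<in> borel_measurable M"
    by (intro lborel.borel_measurable_lebesgue_integral) (simp add: case_prod_eta)
  moreover have "(\<integral>s. F (\<omega>, s) \<partial>lborel) = integral {a..b} (\<lambda>s. f s \<omega>)" if "\<omega> \<in> space M" for \<omega>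
    using set_borel_integral_eq_integral(2)[OF borel_integrable_atLeastAtMost'[OF cont[OF that]]]
    by (simp add: F_def set_lebesgue_integral_def)
  ultimately show ?thesis
    by (subst measurable_cong[of _ _ "\<lambda>\<omega>. \<integral>s. F (\<omega>, s) \<partial>lborel"]) auto
qed

lemma continuous_on_matrix_vector_mult:
  fixes A :: "'t::topological_space \<Rightarrow> real^'n^'m"
  assumes "continuous_on S A" "continuous_on S z"
  shows "continuous_on S (\<lambda>s. A s *v z s)"
  unfolding matrix_vector_mult_def
  by (intro continuous_on_vec_lambda continuous_on_sum continuous_on_mult continuous_on_component assms)

lemma bounded_matrix_vector_mult:
  fixes A :: "'t::topological_space \<Rightarrow> real^'n^'n"
  assumes "continuous_on S A" "compact S"
  obtains C where "C \<ge> 0" "\<And>s x. s \<in> S \<Longrightarrow> norm (A s *v x) \<le> C * norm x"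
proof -
  obtain B where B: "\<And>s. s \<in> S \<Longrightarrow> norm (A s) \<le> B"
    using compact_imp_bounded[OF compact_continuous_image[OF assms]] by (auto simp: bounded_iff)
  have "norm (A s *v x) \<le> (real CARD('n) * \<bar>B\<bar>) * norm x" if "s \<in> S" for s x
  proof -
    have "norm (A s *v x) \<le> (\<Sum>i\<in>UNIV. \<bar>(A s *v x) $ i\<bar>)" by (rule norm_le_l1_cart)
    also have "\<dots> \<le> (\<Sum>i\<in>(UNIV::'n set). \<bar>B\<bar> * norm x)"
    proof (rule sum_mono)
      fix i
      have "\<bar>(A s *v x) $ i\<bar> \<le> norm (A s $ i) * norm x"
        by (simp add: matrix_vector_mul_component Cauchy_Schwarz_ineq2)
      also have "norm (A s $ i) \<le> \<bar>B\<bar>"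
        using Finite_Cartesian_Product.norm_nth_le[of "A s" i] B[OF that] by linarith
      finally show "\<bar>(A s *v x) $ i\<bar> \<le> \<bar>B\<bar> * norm x" by (simp add: mult_right_mono)
    qed
    finally show ?thesis by simp
  qed
  then show thesis using that[of "real CARD('n) * \<bar>B\<bar>"] by auto
qed

section \<open>Picard iteration based at an arbitrary time\<close>

text \<open>Iterates for z(t) = b(t) minus the integral of A z from \<open>p\<close> to
  \<open>t\<close>. Writing this oriented integral as a difference of integrals from 0 treats
  \<open>t < p\<close> and \<open>p \<le> t\<close> alike.\<close>

primrec picard ::
  "(real \<Rightarrow> real^'n^'n) \<Rightarrow> real \<Rightarrow> (real \<Rightarrow> real^'n) \<Rightarrow> nat \<Rightarrow> real \<Rightarrow> real^'n" where
  "picard A p b 0 = b"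
| "picard A p b (Suc k) = (\<lambda>t. b t - (integral {0..t} (\<lambda>s. A s *v picard A p b k s)
                                     - integral {0..p} (\<lambda>s. A s *v picard A p b k s)))"

lemma continuous_on_picard:
  fixes A :: "real \<Rightarrow> real^'n^'n"
  assumes "continuous_on {0..1} A" "continuous_on {0..1} b"
  shows "continuous_on {0..1} (picard A p b k)"
proof (induction k)
  case (Suc k)
  have "(\<lambda>s. A s *v picard A p b k s) integrable_on {0..1}"
    by (intro integrable_continuous_real continuous_on_matrix_vector_mult assms Suc)
  then show ?case
    by (auto intro!: continuous_intros assms indefinite_integral_continuous_1)
qed (use assms in simp)

text \<open>Exposes that only the times between \<open>p\<close> and \<open>t\<close> matter, the
  locality on which the one-sided measurability rests.\<close>

lemma integral_from_zero_diff:
  fixes f :: "real \<Rightarrow> 'b::euclidean_space"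
  assumes "continuous_on {0..1} f" "p \<in> {0..1}" "t \<in> {0..1}"
  shows "integral {0..t} f - integral {0..p} f =
    (if p \<le> t then integral {p..t} f else - integral {t..p} f)"
proof -
  have "f integrable_on {0..u}" if "u \<in> {0..1}" for u
    using that by (intro integrable_continuous_real continuous_on_subset[OF assms(1)]) auto
  then have "f integrable_on {0..t}" "f integrable_on {0..p}" using assms by auto
  moreover have "0 \<le> p" "0 \<le> t" using assms by auto
  ultimately show ?thesis
    using Henstock_Kurzweil_Integration.integral_combine[of 0 p t f]
      Henstock_Kurzweil_Integration.integral_combine[of 0 t p f]
    by (cases "p \<le> t") (simp_all add: eq_diff_eq diff_eq_eq add.commute)
qed

text \<open>One step of the Picard estimate; the divisor \<open>Suc k\<close> builds up the
  factorial.\<close>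

lemma norm_integral_between_le:
  fixes f :: "real \<Rightarrow> 'b::euclidean_space"
  assumes f: "continuous_on {0..1} f" and pt: "p \<in> {0..1}" "t \<in> {0..1}"
    and bound: "\<And>s. s \<in> {0..1} \<Longrightarrow> norm (f s) \<le> B * \<bar>s - p\<bar> ^ k"
  shows "norm (integral {0..t} f - integral {0..p} f) \<le> B * \<bar>t - p\<bar> ^ Suc k / real (Suc k)"
proof (cases "p \<le> t")
  case True
  have "((\<lambda>s. B * (s - p) ^ k) has_integral B * (t - p) ^ Suc k / real (Suc k) - B * (p - p) ^ Suc k / real (Suc k)) {p..t}"
    using True by (intro fundamental_theorem_of_calculus)
      (auto intro!: derivative_eq_intros simp: has_real_derivative_iff_has_vector_derivative[symmetric] simp del: power_Suc)
  then have I: "((\<lambda>s. B * (s - p) ^ k) has_integral B * (t - p) ^ Suc k / real (Suc k)) {p..t}" by simp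
  have "norm (integral {p..t} f) \<le> integral {p..t} (\<lambda>s. B * (s - p) ^ k)"
  proof (rule integral_norm_bound_integral)
    show "f integrable_on {p..t}"
      using pt by (intro integrable_continuous_real continuous_on_subset[OF f]) auto
    show "(\<lambda>s. B * (s - p) ^ k) integrable_on {p..t}" using I by blast
    show "norm (f s) \<le> B * (s - p) ^ k" if "s \<in> {p..t}" for s
      using bound[of s] that pt by auto
  qed
  then show ?thesis
    using integral_unique[OF I] integral_from_zero_diff[OF f pt] True by simp
next
  case False
  have "((\<lambda>s. B * (p - s) ^ k) has_integral (- (B * (p - p) ^ Suc k / real (Suc k))) - (- (B * (p - t) ^ Suc k / real (Suc k)))) {t..p}"
    using False by (intro fundamental_theorem_of_calculus)
      (auto intro!: derivative_eq_intros simp: has_real_derivative_iff_has_vector_derivative[symmetric] simp del: power_Suc)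
  then have I: "((\<lambda>s. B * (p - s) ^ k) has_integral B * (p - t) ^ Suc k / real (Suc k)) {t..p}" by simp
  have "norm (integral {t..p} f) \<le> integral {t..p} (\<lambda>s. B * (p - s) ^ k)"
  proof (rule integral_norm_bound_integral)
    show "f integrable_on {t..p}"
      using pt by (intro integrable_continuous_real continuous_on_subset[OF f]) auto
    show "(\<lambda>s. B * (p - s) ^ k) integrable_on {t..p}" using I by blast
    show "norm (f s) \<le> B * (p - s) ^ k" if "s \<in> {t..p}" for s
      using bound[of s] that pt by auto
  qed
  then show ?thesis
    using integral_unique[OF I] integral_from_zero_diff[OF f pt] False by simp
qed

text \<open>The initial error \<open>b - z\<close> is bounded by some B, and k integrations reduce
  it to B (C |t - p|)^k / k!, a term of an exponential series.\<close>

lemma picard_tendsto: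
  fixes A :: "real \<Rightarrow> real^'n^'n"
  assumes A: "continuous_on {0..1} A" and b: "continuous_on {0..1} b" and z: "continuous_on {0..1} z"
    and p: "p \<in> {0..1}"
    and eq: "\<And>t. t \<in> {0..1} \<Longrightarrow> z t = b t - (integral {0..t} (\<lambda>s. A s *v z s) - integral {0..p} (\<lambda>s. A s *v z s))"
    and t: "t \<in> {0..1}"
  shows "(\<lambda>k. picard A p b k t) \<longlonglongrightarrow> z t"
proof -
  obtain C where C: "C \<ge> 0" "\<And>s x. s \<in> {0..1} \<Longrightarrow> norm (A s *v x) \<le> C * norm x"
    using bounded_matrix_vector_mult[OF A compact_Icc] by blast
  have "bounded ((\<lambda>s. b s - z s) ` {0..1})"
    by (intro compact_imp_bounded compact_continuous_image continuous_intros b z) simp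
  then obtain B where "\<forall>x\<in>(\<lambda>s. b s - z s) ` {0..1}. norm x \<le> B"
    unfolding bounded_iff by blast
  then have B: "norm (b s - z s) \<le> B" if "s \<in> {0..1}" for s using that by blast
  have bound: "norm (picard A p b k t - z t) \<le> (B * C ^ k / fact k) * \<bar>t - p\<bar> ^ k" if "t \<in> {0..1}" for k t
    using that
  proof (induction k arbitrary: t)
    case 0
    then show ?case using B by simp
  next
    case (Suc k)
    define f where "f = (\<lambda>s. A s *v (picard A p b k s - z s))"
    have cf: "continuous_on {0..1} f"
      unfolding f_def by (intro continuous_on_matrix_vector_mult continuous_intros A z continuous_on_picard[OF A b])
    have int: "(\<lambda>s. A s *v picard A p b k s) integrable_on {0..u}" "(\<lambda>s. A s *v z s) integrable_on {0..u}"
      if "u \<in> {0..1}" for u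
      using that
      by (auto intro!: integrable_continuous_real continuous_on_matrix_vector_mult
          intro: continuous_on_subset[OF A] continuous_on_subset[OF z] continuous_on_subset[OF continuous_on_picard[OF A b]])
    have fu: "integral {0..u} f = integral {0..u} (\<lambda>s. A s *v picard A p b k s) - integral {0..u} (\<lambda>s. A s *v z s)"
      if "u \<in> {0..1}" for u
      using integral_diff[OF int[OF that]] by (simp add: f_def matrix_vector_mult_diff_distrib)
    have "picard A p b (Suc k) t - z t = - (integral {0..t} f - integral {0..p} f)"
      unfolding fu[OF Suc.prems] fu[OF p] by (subst eq[OF Suc.prems]) simp
    then have "norm (picard A p b (Suc k) t - z t) = norm (integral {0..t} f - integral {0..p} f)"
      by (simp add: norm_minus_commute)
    also have "\<dots> \<le> (C * (B * C ^ k / fact k)) * \<bar>t - p\<bar> ^ Suc k / real (Suc k)"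
    proof (rule norm_integral_between_le[OF cf p Suc.prems])
      fix s :: real assume s: "s \<in> {0..1}"
      have "norm (f s) \<le> C * norm (picard A p b k s - z s)" unfolding f_def by (rule C(2)[OF s])
      also have "\<dots> \<le> C * ((B * C ^ k / fact k) * \<bar>s - p\<bar> ^ k)"
        by (intro mult_left_mono Suc.IH s C(1))
      finally show "norm (f s) \<le> (C * (B * C ^ k / fact k)) * \<bar>s - p\<bar> ^ k" by (simp add: mult_ac)
    qed
    also have "\<dots> = (B * C ^ Suc k / fact (Suc k)) * \<bar>t - p\<bar> ^ Suc k"
      by (simp add: divide_simps)
    finally show ?case .
  qed
  have "(\<lambda>k. (C * \<bar>t - p\<bar>) ^ k / fact k) \<longlonglongrightarrow> 0"
    using summable_LIMSEQ_zero[OF summable_exp[of "C * \<bar>t - p\<bar>"]] by (simp add: divide_inverse mult.commute)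
  then have "(\<lambda>k. B * ((C * \<bar>t - p\<bar>) ^ k / fact k)) \<longlonglongrightarrow> B * 0"
    by (intro tendsto_mult tendsto_const)
  then have lim: "(\<lambda>k. B * ((C * \<bar>t - p\<bar>) ^ k / fact k)) \<longlonglongrightarrow> 0" by simp
  have "norm (picard A p b k t - z t) \<le> B * ((C * \<bar>t - p\<bar>) ^ k / fact k)" for k
    using bound[OF t, of k] by (simp add: power_mult_distrib mult.assoc)
  then have "(\<lambda>k. picard A p b k t - z t) \<longlonglongrightarrow> 0"
    by (intro Lim_null_comparison[OF _ lim] always_eventually allI)
  then show ?thesis by (rule LIM_zero_cancel)
qed

text \<open>Since \<open>p\<close> and \<open>t\<close> lie in \<open>{u..v}\<close>, every integral
  in the iteration stays inside this interval, so the iterate at \<open>t\<close> uses the forcing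
  only there.\<close>

lemma picard_measurable:
  fixes A :: "real \<Rightarrow> real^'n^'n"
  assumes A: "continuous_on {0..1} A" and b: "\<And>\<omega>. \<omega> \<in> space N \<Longrightarrow> continuous_on {0..1} (\<lambda>t. b t \<omega>)"
    and T: "{u..v} \<subseteq> {0..1}" "p \<in> {u..v}"
    and meas: "\<And>s. s \<in> {u..v} \<Longrightarrow> b s \<in> borel_measurable N" and t: "t \<in> {u..v}"
  shows "(\<lambda>\<omega>. picard A p (\<lambda>t. b t \<omega>) k t) \<in> borel_measurable N"
  using t
proof (induction k arbitrary: t)
  case 0
  then show ?case using meas by simp
next
  case (Suc k)
  let ?f = "\<lambda>s \<omega>. A s *v picard A p (\<lambda>t. b t \<omega>) k s"
  have cf: "continuous_on {0..1} (\<lambda>s. ?f s \<omega>)" if "\<omega> \<in> space N" for \<omega>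
    by (intro continuous_on_matrix_vector_mult continuous_on_picard A b that)
  have fm: "?f s \<in> borel_measurable N" if "s \<in> {u..v}" for s
    using Suc.IH[OF that] borel_measurable_continuous_onI[OF linear_continuous_on[OF matrix_vector_mul_bounded_linear]]
    by (rule measurable_compose)
  have pt: "p \<in> {0..1}" "t \<in> {0..1}" using T Suc.prems by auto
  have "(\<lambda>\<omega>. b t \<omega> - (if p \<le> t then integral {p..t} (\<lambda>s. ?f s \<omega>) else - integral {t..p} (\<lambda>s. ?f s \<omega>))) \<in> borel_measurable N"
  proof (cases "p \<le> t")
    case True
    have "(\<lambda>\<omega>. integral {p..t} (\<lambda>s. ?f s \<omega>)) \<in> borel_measurable N"
      using fm Suc.prems T pt
      by (intro borel_measurable_integral_continuous continuous_on_subset[OF cf]) auto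
    then show ?thesis using True meas[OF Suc.prems] by simp
  next
    case False
    have "(\<lambda>\<omega>. integral {t..p} (\<lambda>s. ?f s \<omega>)) \<in> borel_measurable N"
      using fm Suc.prems T pt
      by (intro borel_measurable_integral_continuous continuous_on_subset[OF cf]) auto
    then show ?thesis using False meas[OF Suc.prems] by simp
  qed
  then show ?case
    by (subst measurable_cong[where g="\<lambda>\<omega>. b t \<omega> - (if p \<le> t then integral {p..t} (\<lambda>s. ?f s \<omega>) else - integral {t..p} (\<lambda>s. ?f s \<omega>))"])
       (simp_all only: picard.simps integral_from_zero_diff[OF cf pt])
qed

text \<open>A pointwise limit of the iterates. With \<open>{0..p}\<close> or \<open>{p..1}\<close>
  for \<open>{u..v}\<close> it yields the dependence on the noise of one side.\<close>

lemma linear_integral_equation_measurable: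
  fixes A :: "real \<Rightarrow> real^'n^'n"
  assumes A: "continuous_on {0..1} A" and b: "\<And>\<omega>. \<omega> \<in> space N \<Longrightarrow> continuous_on {0..1} (\<lambda>t. b t \<omega>)"
    and z: "\<And>\<omega>. \<omega> \<in> space N \<Longrightarrow> continuous_on {0..1} (\<lambda>t. z t \<omega>)"
    and eq: "\<And>t \<omega>. t \<in> {0..1} \<Longrightarrow> \<omega> \<in> space N \<Longrightarrow> z t \<omega> = b t \<omega> -
      (integral {0..t} (\<lambda>s. A s *v z s \<omega>) - integral {0..p} (\<lambda>s. A s *v z s \<omega>))"
    and T: "{u..v} \<subseteq> {0..1}" "p \<in> {u..v}"
    and meas: "\<And>s. s \<in> {u..v} \<Longrightarrow> b s \<in> borel_measurable N" and t: "t \<in> {u..v}"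
  shows "z t \<in> borel_measurable N"
proof (rule borel_measurable_LIMSEQ_metric)
  show "(\<lambda>\<omega>. picard A p (\<lambda>t. b t \<omega>) k t) \<in> borel_measurable N" for k
    by (rule picard_measurable[OF A b T meas t])
  show "(\<lambda>k. picard A p (\<lambda>t. b t \<omega>) k t) \<longlonglongrightarrow> z t \<omega>" if "\<omega> \<in> space N" for \<omega>
    by (rule picard_tendsto[OF A b[OF that] z[OF that] _ eq[OF _ that]]) (use T t in auto)
qed

text \<open>The same iterates, with forcing 0, converge both to \<open>z\<close> and to the zero
  solution.\<close>

lemma linear_integral_equation_unique:
  fixes A :: "real \<Rightarrow> real^'n^'n"
  assumes A: "continuous_on {0..1} A" and z: "continuous_on {0..1} z" and p: "p \<in> {0..1}" "z p = 0"
    and eq: "\<And>t. t \<in> {0..1} \<Longrightarrow> z t - z 0 + integral {0..t} (\<lambda>s. A s *v z s) = 0"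
    and t: "t \<in> {0..1}"
  shows "z t = 0"
proof (rule LIMSEQ_unique)
  have "z t = 0 - (integral {0..t} (\<lambda>s. A s *v z s) - integral {0..p} (\<lambda>s. A s *v z s))" if "t \<in> {0..1}" for t
    using eq[OF that] eq[OF p(1)] p(2) by (simp add: algebra_simps)
  then show "(\<lambda>k. picard A p (\<lambda>_. 0) k t) \<longlonglongrightarrow> z t"
    by (intro picard_tendsto[OF A _ z p(1) _ t]) auto
  show "(\<lambda>k. picard A p (\<lambda>_. 0) k t) \<longlonglongrightarrow> 0"
    by (intro picard_tendsto[OF A _ _ p(1) _ t, where z="\<lambda>_. 0"]) auto
qed

text \<open>Bridges the integral form of the solutions and the differential form in which
  \<open>well_posed\<close> is stated.\<close>

lemma linear_integral_equation_derivative: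
  fixes A :: "real \<Rightarrow> real^'n^'n"
  assumes A: "continuous_on {0..1} A" and z: "continuous_on {0..1} z"
    and eq: "\<And>t. t \<in> {0..1} \<Longrightarrow> z t - z 0 + integral {0..t} (\<lambda>s. A s *v z s) = 0"
    and t: "t \<in> {0..1}"
  shows "(z has_vector_derivative - (A t *v z t)) (at t within {0..1})"
proof -
  have "((\<lambda>u. z 0 - integral {0..u} (\<lambda>s. A s *v z s)) has_vector_derivative 0 - (A t *v z t)) (at t within {0..1})"
    by (intro has_vector_derivative_diff has_vector_derivative_const integral_has_vector_derivative
        continuous_on_matrix_vector_mult A z t)
  then show ?thesis
    unfolding diff_0
    by (rule has_vector_derivative_transform[OF t, rotated]) (use eq in \<open>simp add: algebra_simps\<close>)
qed

section \<open>Paths with prescribed values\<close>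

text \<open>Each differentiation costs at most one factor X - x, so fewer than \<open>n\<close> of
  them leave one.\<close>

lemma poly_higher_pderiv_root:
  fixes q :: "real poly"
  assumes "[:-x, 1:] ^ n dvd q" "k < n"
  shows "poly ((pderiv ^^ k) q) x = 0"
proof -
  have "[:-x, 1:] ^ (n - k) dvd (pderiv ^^ k) q" if "k \<le> n" for k
    using that
  proof (induction k)
    case 0
    then show ?case using assms by simp
  next
    case (Suc k)
    then obtain s where s: "(pderiv ^^ k) q = [:-x, 1:] ^ Suc (n - Suc k) * s"
      by (metis Suc_diff_Suc Suc_le_lessD dvdE less_imp_le)
    have "(pderiv ^^ Suc k) q = [:-x, 1:] ^ (n - Suc k) *
        ([:-x, 1:] * pderiv s + smult (of_nat (Suc (n - Suc k))) s)"
      unfolding funpow.simps comp_def s pderiv_mult pderiv_power_Suc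
      by (simp add: pderiv_pCons algebra_simps)
    then show ?case by simp
  qed
  from this[of k] have "[:-x, 1:] ^ (n - k) dvd (pderiv ^^ k) q" using assms by simp
  moreover have "[:-x, 1:] dvd [:-x, 1:] ^ (n - k)" using assms by (intro dvd_power) auto
  ultimately show ?thesis using poly_eq_0_iff_dvd dvd_trans by blast
qed

text \<open>Lagrange interpolation of the quotients x_j / (\<tau>_j - p)^n, multiplied by (X -
  p)^n.\<close>

lemma interpolation_poly_root:
  fixes \<tau> :: "'m::finite \<Rightarrow> real" and x :: "'m \<Rightarrow> real"
  assumes "inj \<tau>" and zero: "\<And>j. \<tau> j = p \<Longrightarrow> x j = 0" and n: "n > 0"
  obtains q where "\<And>j. poly q (\<tau> j) = x j" "\<And>k. k < n \<Longrightarrow> poly ((pderiv ^^ k) q) p = 0"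
proof -
  define l where "l j = (\<Prod>k\<in>UNIV - {j}. [:- \<tau> k, 1:])" for j
  \<comment> \<open>If \<open>\<tau> j = p\<close> the quotient is 0 by the convention for division
    by zero; the factor (X - p)^n gives the required value 0 there.\<close>
  define s where "s = (\<Sum>j\<in>UNIV. smult (x j / (\<tau> j - p) ^ n / poly (l j) (\<tau> j)) (l j))"
  define q where "q = [:-p, 1:] ^ n * s"
  have l: "poly (l j) (\<tau> i) = 0 \<longleftrightarrow> i \<noteq> j" for i j
    using injD[OF assms(1)] by (auto simp: l_def poly_prod)
  have "poly s (\<tau> i) = x i / (\<tau> i - p) ^ n" for i
  proof -
    have "poly s (\<tau> i) = (\<Sum>j\<in>UNIV. if j = i then x i / (\<tau> i - p) ^ n else 0)"
      unfolding s_def poly_sum using l by (intro sum.cong) auto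
    then show ?thesis by simp
  qed
  then have "poly q (\<tau> i) = x i" for i
    using zero n by (cases "\<tau> i = p") (auto simp: q_def poly_power)
  moreover have "poly ((pderiv ^^ k) q) p = 0" if "k < n" for k
    using that by (intro poly_higher_pderiv_root[of p n]) (auto simp: q_def)
  ultimately show thesis using that by blast
qed

section \<open>Index positions and the companion matrix\<close>

lemma pos_strict_mono: "strict_mono (pos :: 'n::{finite,linorder} \<Rightarrow> nat)"
proof (rule strict_monoI)
  fix i j :: 'n assume "i < j"
  then have "{..i} \<subset> {..j}" by auto
  then show "pos i < pos j" unfolding pos_def by (intro psubset_card_mono) auto
qed

lemma bij_betw_pos: "bij_betw (pos :: 'n::{finite,linorder} \<Rightarrow> nat) UNIV {1..CARD('n)}"
proof -
  have inj: "inj (pos :: 'n \<Rightarrow> nat)" using pos_strict_mono by (rule strict_mono_imp_inj_on)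
  have "range (pos :: 'n \<Rightarrow> nat) \<subseteq> {1..CARD('n)}"
    by (auto simp: pos_def Suc_le_eq card_gt_0_iff intro!: card_mono)
  moreover have "card (range (pos :: 'n \<Rightarrow> nat)) = CARD('n)" using inj by (simp add: card_image)
  ultimately have "range (pos :: 'n \<Rightarrow> nat) = {1..CARD('n)}" by (intro card_subset_eq) auto
  with inj show ?thesis by (simp add: bij_betw_def)
qed

lemma pos_bounds: "1 \<le> pos (i :: 'n::{finite,linorder})" "pos i \<le> CARD('n)"
  using bij_betw_apply[OF bij_betw_pos, of i] by auto

lemma pos_eq_iff: "pos i = pos j \<longleftrightarrow> i = (j :: 'n::{finite,linorder})"
  using strict_mono_eq[OF pos_strict_mono] .

lemma pos_surj:
  assumes "1 \<le> k" "k \<le> CARD('n::{finite,linorder})"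
  obtains i :: "'n::{finite,linorder}" where "pos i = k"
  using assms bij_betw_imp_surj_on[OF bij_betw_pos] by (metis atLeastAtMost_iff imageE)

lemma pos_Max: "pos (Max UNIV :: 'n::{finite,linorder}) = CARD('n)"
  unfolding pos_def by (rule arg_cong[where f=card]) auto

lemma continuous_on_companion:
  assumes "\<And>k. k < CARD('n) \<Longrightarrow> continuous_on S (a k)"
  shows "continuous_on S (companion a :: real \<Rightarrow> real^'n::{finite,linorder}^'n::{finite,linorder})"
proof -
  have "CARD('n) - pos j < CARD('n)" for j :: 'n using pos_bounds[of j] by linarith
  then have "continuous_on S (\<lambda>t. if pos i = 1 then a (CARD('n) - pos j) t
      else if pos i = pos j + 1 then - 1 else 0)" for i j :: 'n
    using assms by (cases "pos i = 1") auto
  then show ?thesis unfolding companion_def by (intro continuous_on_vec_lambda)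
qed

text \<open>Below the first row the single entry -1 sits at the predecessor, so the system reads D
  Y_i = Y_(i-1) there.\<close>

lemma companion_mult_component:
  fixes x :: "real^'n::{finite,linorder}"
  assumes "pos i = pos j + 1"
  shows "(companion a s *v x) $ i = - x $ j"
proof -
  have "companion a s $ i $ k * x $ k = (if k = j then - x $ k else 0)" for k
    using assms pos_bounds(1)[of j] pos_eq_iff[of k j] by (auto simp: companion_def)
  then have "(companion a s *v x) $ i = (\<Sum>k\<in>UNIV. if k = j then - x $ k else 0)"
    by (simp add: matrix_vector_mult_def)
  then show ?thesis by simp
qed

section \<open>Polynomial paths and the controls that drive them\<close>

text \<open>The vector of derivatives of q, of orders n - 1 down to 0: the first order form of the
  scalar function q.\<close>

definition poly_path :: "real poly \<Rightarrow> real \<Rightarrow> real^'n::{finite,linorder}" where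
  "poly_path q t = (\<chi> i. poly ((pderiv ^^ (CARD('n) - pos i)) q) t)"

text \<open>The control \<open>L[q]\<close> integrated from 0: driving the system with it produces \<open>poly_path q\<close>.\<close>
definition poly_noise ::
  "(nat \<Rightarrow> real \<Rightarrow> real) \<Rightarrow> 'n::{finite,linorder} itself \<Rightarrow> real poly \<Rightarrow> real \<Rightarrow> real" where
  "poly_noise a (_ :: 'n itself) q t = integral {0..t} (\<lambda>s. poly ((pderiv ^^ CARD('n)) q) s
     + (\<Sum>j\<in>UNIV. a (CARD('n) - pos j) s * (poly_path q s :: real^'n::{finite,linorder}) $ j))"

lemma last_component_poly_path [simp]: "last_component (poly_path q t) = poly q t"
  by (simp add: last_component_def poly_path_def pos_Max)

lemma continuous_on_poly_path: "continuous_on S (poly_path q)"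
  unfolding poly_path_def by (intro continuous_on_vec_lambda continuous_intros)

lemma integral_pderiv:
  assumes "0 \<le> t"
  shows "integral {0..t} (poly (pderiv q)) = poly q t - poly q (0::real)"
  using assms
  by (intro integral_unique fundamental_theorem_of_calculus)
     (auto simp: has_real_derivative_iff_has_vector_derivative[symmetric] intro: DERIV_subset[OF poly_DERIV])

context
  fixes a :: "nat \<Rightarrow> real \<Rightarrow> real"
  assumes a: "\<And>k. k < CARD('n::{finite,linorder}) \<Longrightarrow> continuous_on {0..1} (a k)"
begin

lemma continuous_on_control:
  "continuous_on {0..1} (\<lambda>s. poly ((pderiv ^^ CARD('n)) q) s
     + (\<Sum>j\<in>UNIV. a (CARD('n) - pos j) s * (poly_path q s :: real^'n::{finite,linorder}) $ j))"
proof -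
  have "CARD('n) - pos j < CARD('n)" for j :: 'n using pos_bounds[of j] by linarith
  then show ?thesis
    by (intro continuous_intros continuous_on_component continuous_on_poly_path a) auto
qed

text \<open>The integrand is continuous, hence bounded on the unit interval. This makes the control
  an admissible Cameron-Martin shift.\<close>

lemma poly_noise_lipschitz:
  obtains C where "\<And>s t. s \<in> {0..1} \<Longrightarrow> t \<in> {0..1} \<Longrightarrow>
    \<bar>poly_noise a TYPE('n) q t - poly_noise a TYPE('n) q s\<bar> \<le> C * \<bar>t - s\<bar>"
proof -
  let ?G = "\<lambda>s. poly ((pderiv ^^ CARD('n)) q) s
     + (\<Sum>j\<in>UNIV. a (CARD('n) - pos j) s * (poly_path q s :: real^'n::{finite,linorder}) $ j)"
  have "bounded (?G ` {0..1})"
    by (intro compact_imp_bounded compact_continuous_image continuous_on_control) simp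
  then obtain C where "\<forall>x\<in>?G ` {0..1}. norm x \<le> C" unfolding bounded_iff by blast
  then have C: "norm (?G s) \<le> C * \<bar>s - r\<bar> ^ 0" if "s \<in> {0..1}" for s r using that by force
  show thesis
    using norm_integral_between_le[OF continuous_on_control, where k=0 and B=C] C
    by (intro that[of C]) (auto simp: poly_noise_def)
qed

text \<open>The lower rows are the fundamental theorem of calculus for successive derivatives; the
  first row holds by the choice of the control.\<close>

lemma poly_path_equation:
  assumes t: "t \<in> {0..1}"
  shows "poly_path q t - poly_path q 0 + integral {0..t} (\<lambda>s. companion a s *v poly_path q s)
    = (\<chi> i::'n. if pos i = 1 then poly_noise a TYPE('n) q t else 0)"
  unfolding vec_eq_iff
proof
  fix i :: 'n
  let ?y = "poly_path q :: real \<Rightarrow> real^'n::{finite,linorder}"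
  have "continuous_on {0..1} (\<lambda>s. companion a s *v ?y s)"
    by (intro continuous_on_matrix_vector_mult continuous_on_companion[OF a] continuous_on_poly_path)
  then have "continuous_on {0..t} (\<lambda>s. companion a s *v ?y s)"
    using t by (auto intro: continuous_on_subset)
  then have int: "(\<lambda>s. companion a s *v ?y s) integrable_on {0..t}"
    by (rule integrable_continuous_real)
  have comp: "integral {0..t} (\<lambda>s. companion a s *v ?y s) $ i = integral {0..t} (\<lambda>s. (companion a s *v ?y s) $ i)"
    by (rule integral_component_eq_cart[OF int, symmetric])
  show "(?y t - ?y 0 + integral {0..t} (\<lambda>s. companion a s *v ?y s)) $ i =
      (\<chi> i::'n. if pos i = 1 then poly_noise a TYPE('n) q t else 0) $ i"
  proof (cases "pos i = 1")
    case True
    have "(pderiv ^^ CARD('n)) q = pderiv ((pderiv ^^ (CARD('n) - pos i)) q)"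
      using True by (cases "CARD('n)") auto
    then have "?y t $ i - ?y 0 $ i = integral {0..t} (poly ((pderiv ^^ CARD('n)) q))"
      using t integral_pderiv[of t "(pderiv ^^ (CARD('n) - pos i)) q"] by (simp add: poly_path_def)
    moreover have "(companion a s *v ?y s) $ i = (\<Sum>j\<in>UNIV. a (CARD('n) - pos j) s * ?y s $ j)" for s
      using True by (simp add: companion_def matrix_vector_mult_def)
    moreover have "(\<lambda>s. \<Sum>j\<in>UNIV. a (CARD('n) - pos j) s * ?y s $ j) integrable_on {0..t}"
    proof -
      have "CARD('n) - pos j < CARD('n)" for j :: 'n using pos_bounds[of j] by linarith
      then have "continuous_on {0..1} (\<lambda>s. \<Sum>j\<in>UNIV. a (CARD('n) - pos j) s * ?y s $ j)"
        by (intro continuous_intros continuous_on_component continuous_on_poly_path a) auto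
      then show ?thesis
        using t by (intro integrable_continuous_real) (auto intro: continuous_on_subset)
    qed
    ultimately show ?thesis
      using True by (simp add: comp poly_noise_def)
        (subst integral_add; auto intro!: integrable_continuous_real continuous_intros)
  next
    case False
    then have k: "1 \<le> pos i - 1" "pos i - 1 \<le> CARD('n)" using pos_bounds[of i] by auto
    obtain j :: 'n where j: "pos j = pos i - 1" using pos_surj[OF k] .
    have ij: "pos i = pos j + 1" using j k by simp
    have "CARD('n) - pos j = Suc (CARD('n) - pos i)" using ij pos_bounds[of i] by simp
    then have "(\<lambda>s. (companion a s *v ?y s) $ i) = (\<lambda>s. - poly (pderiv ((pderiv ^^ (CARD('n) - pos i)) q)) s)"
      by (simp add: companion_mult_component[OF ij] poly_path_def)
    then show ?thesis
      using False t integral_pderiv[of t "(pderiv ^^ (CARD('n) - pos i)) q"]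
      by (simp add: comp) (simp add: poly_path_def)
  qed
qed

end

section \<open>The boundary value problem\<close>

lemma boundary_diff: "boundary \<alpha> \<tau> (\<lambda>t. x t - y t) = boundary \<alpha> \<tau> x - boundary \<alpha> \<tau> y"
  by (simp add: boundary_def last_component_def vec_eq_iff sum_subtractf right_diff_distrib)

lemma boundary_sum_scaleR:
  "boundary \<alpha> \<tau> (\<lambda>t. \<Sum>k\<in>K. v k *\<^sub>R y k t) = (\<Sum>k\<in>K. v k *\<^sub>R boundary \<alpha> \<tau> (y k))"
  by (simp add: boundary_def last_component_def vec_eq_iff sum_distrib_left mult_ac sum.swap[of _ K])

lemma borel_measurable_last_component:
  "y \<in> borel_measurable N \<Longrightarrow> (\<lambda>\<omega>. last_component (y \<omega>)) \<in> borel_measurable N"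
  unfolding last_component_def
  by (rule measurable_compose[OF _ borel_measurable_continuous_onI]) (auto intro!: continuous_intros)

lemma borel_measurable_vec_component:
  "y \<in> borel_measurable N \<Longrightarrow> (\<lambda>\<omega>. y \<omega> $ i) \<in> borel_measurable N"
  by (rule measurable_compose[OF _ borel_measurable_continuous_onI]) (auto intro!: continuous_intros)

text \<open>\<open>p_supp\<close> keeps \<open>p\<close> off the support, yet
  \<open>\<tau> j = p\<close> can still happen when column \<open>j\<close> of \<alpha> is zero.
  Hence values prescribed at the times must be 0 wherever \<open>\<tau> j = p\<close>.\<close>

locale wiener_boundary_problem =
  fixes P :: "(real \<Rightarrow> real) measure"
    and a :: "nat \<Rightarrow> real \<Rightarrow> real"
    and \<alpha> :: "real^'m::{finite,linorder}^'n::{finite,linorder}"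
    and \<tau> :: "'m \<Rightarrow> real"
    and c :: "real^'n::{finite,linorder}"
    and Y :: "real \<Rightarrow> (real \<Rightarrow> real) \<Rightarrow> real^'n::{finite,linorder}"
    and p :: real
    and f :: "'n \<Rightarrow> 'm"
  assumes W: "wiener_measure P"
    and a: "\<And>k. k < CARD('n) \<Longrightarrow> continuous_on {0..1} (a k)"
    and inj_\<tau>: "inj \<tau>" and \<tau>01: "\<And>j. \<tau> j \<in> {0..1}"
    and inj_f: "inj f" and f: "\<And>i k. \<alpha> $ i $ f k = (if i = k then 1 else 0)"
    and wp: "well_posed a \<alpha> \<tau>"
    and sol: "\<And>\<omega>. \<omega> \<in> space P \<Longrightarrow> path_solution a \<alpha> \<tau> c \<omega> (\<lambda>t. Y t \<omega>)"
    and p01: "p \<in> {0..1}"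
    and p_supp: "\<And>i j. \<alpha> $ i $ j \<noteq> 0 \<Longrightarrow> \<tau> j \<noteq> p"
begin

abbreviation "A \<equiv> companion a :: real \<Rightarrow> real^'n::{finite,linorder}^'n::{finite,linorder}"

definition homogeneous :: "(real \<Rightarrow> real^'n::{finite,linorder}) \<Rightarrow> bool" where
  "homogeneous z \<longleftrightarrow> continuous_on {0..1} z \<and>
     (\<forall>t\<in>{0..1}. z t - z 0 + integral {0..t} (\<lambda>s. A s *v z s) = 0)"

lemma A_cont: "continuous_on {0..1} A"
  by (rule continuous_on_companion[where a=a, OF a])

sublocale prob_space P
  using W by (simp add: wiener_measure_def)

lemma Y_cont: "\<omega> \<in> space P \<Longrightarrow> continuous_on {0..1} (\<lambda>t. Y t \<omega>)"
  and Y_eq: "\<omega> \<in> space P \<Longrightarrow> t \<in> {0..1} \<Longrightarrow>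
    Y t \<omega> - Y 0 \<omega> + integral {0..t} (\<lambda>s. A s *v Y s \<omega>) = noise t \<omega>"
  and Y_boundary: "\<omega> \<in> space P \<Longrightarrow> boundary \<alpha> \<tau> (\<lambda>t. Y t \<omega>) = c"
  using sol by (auto simp: path_solution_def)

lemma integrable_mult_path:
  "continuous_on {0..1} z \<Longrightarrow> t \<in> {0..1} \<Longrightarrow> (\<lambda>s. A s *v z s) integrable_on {0..t}"
  by (rule integrable_continuous_real, rule continuous_on_subset[where s="{0..1}"])
     (auto intro!: continuous_on_matrix_vector_mult A_cont)

lemma integral_mult_diff:
  assumes "continuous_on {0..1} z" "continuous_on {0..1} z'" "t \<in> {0..1}"
  shows "integral {0..t} (\<lambda>s. A s *v (z s - z' s)) =
    integral {0..t} (\<lambda>s. A s *v z s) - integral {0..t} (\<lambda>s. A s *v z' s)"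
  using integral_diff[OF integrable_mult_path[OF assms(1,3)] integrable_mult_path[OF assms(2,3)]]
  by (simp add: matrix_vector_mult_diff_distrib)

lemma homogeneous_zero_boundary:
  assumes "homogeneous z" "boundary \<alpha> \<tau> z = 0" "t \<in> {0..1}"
  shows "z t = 0"
proof -
  have "(z has_vector_derivative - (A t *v z t)) (at t within {0..1})" if "t \<in> {0..1}" for t
    using assms(1) that
    by (intro linear_integral_equation_derivative[OF A_cont]) (auto simp: homogeneous_def)
  then show ?thesis using wp assms(2,3) unfolding well_posed_def by blast
qed

lemma homogeneous_zero_at:
  assumes "homogeneous z" "z p = 0" "t \<in> {0..1}"
  shows "z t = 0"
  by (rule linear_integral_equation_unique[OF A_cont _ p01]) (use assms in \<open>auto simp: homogeneous_def\<close>)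

lemma homogeneous_sum_scaleR:
  assumes "\<And>k. k \<in> K \<Longrightarrow> homogeneous (y k)" "finite K"
  shows "homogeneous (\<lambda>t. \<Sum>k\<in>K. v k *\<^sub>R y k t)"
  unfolding homogeneous_def
proof (intro conjI ballI)
  show "continuous_on {0..1} (\<lambda>t. \<Sum>k\<in>K. v k *\<^sub>R y k t)"
    using assms by (intro continuous_intros) (auto simp: homogeneous_def)
  fix t :: real assume t: "t \<in> {0..1}"
  have "A s *v (\<Sum>k\<in>K. v k *\<^sub>R y k s) = (\<Sum>k\<in>K. v k *\<^sub>R (A s *v y k s))" for s
    by (simp add: linear_sum[OF matrix_vector_mul_linear] matrix_vector_mult_scaleR)
  moreover have "integral {0..t} (\<lambda>s. \<Sum>k\<in>K. v k *\<^sub>R (A s *v y k s)) =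
      (\<Sum>k\<in>K. v k *\<^sub>R integral {0..t} (\<lambda>s. A s *v y k s))"
    using assms t
    by (subst integral_sum) (auto intro!: integrable_cmul integrable_mult_path simp: homogeneous_def)
  moreover have "(\<Sum>k\<in>K. v k *\<^sub>R (y k t - y k 0 + integral {0..t} (\<lambda>s. A s *v y k s))) = 0"
    using assms t by (intro sum.neutral) (auto simp: homogeneous_def)
  ultimately show "(\<Sum>k\<in>K. v k *\<^sub>R y k t) - (\<Sum>k\<in>K. v k *\<^sub>R y k 0) +
      integral {0..t} (\<lambda>s. A s *v (\<Sum>k\<in>K. v k *\<^sub>R y k s)) = 0"
    by (simp add: sum_subtractf sum.distrib scaleR_diff_right scaleR_add_right)
qed

lemma ctrl_lipschitz:
  obtains C where "\<And>s t. s \<in> {0..1} \<Longrightarrow> t \<in> {0..1} \<Longrightarrow> \<bar>poly_noise a TYPE('n) q t - poly_noise a TYPE('n) q s\<bar> \<le> C * \<bar>t - s\<bar>"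
  using poly_noise_lipschitz[where a=a, OF a] by blast

lemma ctrl_zero: "poly_noise a TYPE('n) q 0 = 0"
  by (simp add: poly_noise_def)

lemma path_shift_space:
  assumes "\<omega> \<in> space P"
  shows "path_shift (poly_noise a TYPE('n) q) \<omega> \<in> space P"
proof (rule path_shift_in_space[OF W])
  show "poly_noise a TYPE('n) q 0 = 0" by (rule ctrl_zero)
  show "\<omega> \<in> space P" by (rule assms)
  have "(\<lambda>s. poly ((pderiv ^^ CARD('n)) q) s + (\<Sum>j\<in>UNIV. a (CARD('n) - pos j) s *
      (poly_path q s :: real^'n::{finite,linorder}) $ j)) integrable_on {0..1}"
    by (intro integrable_continuous_real continuous_on_control[where a=a, OF a])
  then show "continuous_on {0..1} (poly_noise a TYPE('n) q)"
    unfolding poly_noise_def by (rule indefinite_integral_continuous_1)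
qed

lemma poly_path_eq:
  assumes "t \<in> {0..1}"
  shows "poly_path q t - poly_path q 0 + integral {0..t} (\<lambda>s. A s *v poly_path q s)
    = (\<chi> i. if pos i = 1 then poly_noise a TYPE('n) q t else 0)"
  by (rule poly_path_equation[OF _ assms]) (rule a)

text \<open>By linearity the three noises cancel. The lemma is used twice: to manufacture
  homogeneous solutions, and to compute the effect of a shift on \<open>Y\<close>.\<close>

lemma homogeneous_shift:
  assumes \<omega>: "\<omega> \<in> space P"
  shows "homogeneous (\<lambda>t. Y t (path_shift (poly_noise a TYPE('n) q) \<omega>) - Y t \<omega> - poly_path q t)"
  unfolding homogeneous_def
proof (intro conjI ballI)
  let ?\<omega>' = "path_shift (poly_noise a TYPE('n) q) \<omega>"
  note \<omega>' = path_shift_space[OF \<omega>, where q=q]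
  have cd: "continuous_on {0..1} (\<lambda>t. Y t ?\<omega>' - Y t \<omega>)"
    by (intro continuous_intros Y_cont \<omega> \<omega>')
  show "continuous_on {0..1} (\<lambda>t. Y t ?\<omega>' - Y t \<omega> - poly_path q t)"
    by (intro continuous_intros cd continuous_on_poly_path)
  fix t :: real assume t: "t \<in> {0..1}"
  have "noise t ?\<omega>' - noise t \<omega> = (\<chi> i::'n. if pos i = 1 then poly_noise a TYPE('n) q t else 0)"
    using t by (auto simp: noise_def vec_eq_iff path_shift_def)
  then have "noise t ?\<omega>' - noise t \<omega> - (poly_path q t - poly_path q 0 + integral {0..t} (\<lambda>s. A s *v poly_path q s)) = 0"
    by (simp add: poly_path_eq[OF t])
  then show "Y t ?\<omega>' - Y t \<omega> - poly_path q t - (Y 0 ?\<omega>' - Y 0 \<omega> - poly_path q 0) +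
      integral {0..t} (\<lambda>s. A s *v (Y s ?\<omega>' - Y s \<omega> - poly_path q s)) = 0"
    unfolding integral_mult_diff[OF cd continuous_on_poly_path t]
      integral_mult_diff[OF Y_cont[OF \<omega>'] Y_cont[OF \<omega>] t]
      Y_eq[OF \<omega> t, symmetric] Y_eq[OF \<omega>' t, symmetric]
    by (simp add: algebra_simps)
qed

lemma path_space_nonempty: obtains \<omega> where "\<omega> \<in> space P"
  using not_empty by blast

text \<open>Basic columns form an identity matrix, so placing \<open>v k\<close> on column
  \<open>f k\<close> realises any prescribed image \<open>v\<close> under \<alpha>.\<close>

lemma sum_basic_columns:
  "(\<Sum>j\<in>UNIV. \<alpha> $ i $ j * (\<Sum>k\<in>UNIV. if j = f k then v k else 0)) = v i"
proof -
  have "(\<Sum>j\<in>UNIV. \<alpha> $ i $ j * (\<Sum>k\<in>UNIV. if j = f k then v k else 0)) =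
      (\<Sum>k\<in>UNIV. \<Sum>j\<in>UNIV. if j = f k then \<alpha> $ i $ j * v k else 0)"
    by (subst sum.swap) (auto simp: sum_distrib_left intro!: sum.cong)
  also have "\<dots> = (\<Sum>k\<in>UNIV. \<alpha> $ i $ f k * v k)" by simp
  also have "\<dots> = v i" by (simp add: f if_distrib[of "\<lambda>x. x * _"] cong: if_cong)
  finally show ?thesis .
qed

lemma basic_column_not_p: "\<tau> (f k) \<noteq> p"
  using p_supp[of k "f k"] f by simp

text \<open>The solutions for the shifted and the original noise both have boundary value
  \<open>c\<close>, so in \<open>homogeneous_shift\<close> only the polynomial path contributes.
  Interpolating -e on the basic columns leaves boundary value e; any path of the space serves as
  base point.\<close>

lemma homogeneous_boundary_exists: "\<exists>z. homogeneous z \<and> boundary \<alpha> \<tau> z = e"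
proof -
  define x where "x j = (\<Sum>k\<in>UNIV. if j = f k then - e $ k else 0)" for j
  have x0: "x j = 0" if "\<tau> j = p" for j
    unfolding x_def using basic_column_not_p that by (intro sum.neutral) auto
  obtain q where q: "\<And>j. poly q (\<tau> j) = x j"
    by (rule interpolation_poly_root[where n="CARD('n)" and p=p and x=x and \<tau>=\<tau>]) (use inj_\<tau> x0 in auto)
  obtain \<omega> where \<omega>: "\<omega> \<in> space P" by (rule path_space_nonempty)
  let ?z = "\<lambda>t. Y t (path_shift (poly_noise a TYPE('n) q) \<omega>) - Y t \<omega> - poly_path q t"
  have "boundary \<alpha> \<tau> ?z = - boundary \<alpha> \<tau> (poly_path q)"
    unfolding boundary_diff using Y_boundary \<omega> path_shift_space[OF \<omega>, where q=q] by simp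
  also have "\<dots> = e"
    using sum_basic_columns[of _ "\<lambda>k. - e $ k"] by (simp add: boundary_def vec_eq_iff q x_def)
  finally show ?thesis using homogeneous_shift[OF \<omega>] by blast
qed

section \<open>Decomposition at the time p\<close>

definition \<psi> :: "'n \<Rightarrow> real \<Rightarrow> real^'n::{finite,linorder}" where
  "\<psi> k = (SOME z. homogeneous z \<and> boundary \<alpha> \<tau> z = axis k 1)"

lemma \<psi>: "homogeneous (\<psi> k)" "boundary \<alpha> \<tau> (\<psi> k) = axis k 1"
  using someI_ex[OF homogeneous_boundary_exists[of "axis k 1"]] by (auto simp: \<psi>_def)

lemma boundary_\<psi>: "boundary \<alpha> \<tau> (\<lambda>t. \<Sum>k\<in>UNIV. v $ k *\<^sub>R \<psi> k t) = v"
  using basis_expansion[of v] by (simp add: boundary_sum_scaleR \<psi>(2) scalar_mult_eq_scaleR)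

definition N where "N = (\<chi> i k. \<psi> k p $ i)"

lemma N_mult: "N *v v = (\<Sum>k\<in>UNIV. v $ k *\<^sub>R \<psi> k p)"
  by (simp add: N_def matrix_vector_mult_def vec_eq_iff mult.commute)

text \<open>A homogeneous solution that vanishes at \<open>p\<close> vanishes throughout, so its
  boundary value, which is the coefficient vector, is 0. Hence \<open>N\<close> is injective and,
  being square, invertible.\<close>

lemma N_inverse: "\<exists>M. \<forall>v. N *v (M *v v) = v"
proof -
  have "v = 0" if "N *v v = 0" for v
  proof -
    let ?z = "\<lambda>t. \<Sum>k\<in>UNIV. v $ k *\<^sub>R \<psi> k t"
    have "?z t = 0" if "t \<in> {0..1}" for t
      using homogeneous_zero_at[OF homogeneous_sum_scaleR[OF \<psi>(1)] _ that, of UNIV "\<lambda>k. v $ k"] \<open>N *v v = 0\<close>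
      by (simp add: N_mult)
    then have "boundary \<alpha> \<tau> ?z = 0"
      using \<tau>01 by (simp add: boundary_def vec_eq_iff last_component_def)
    then show ?thesis by (simp add: boundary_\<psi>)
  qed
  then have "\<exists>M. M ** N = mat 1"
    by (simp add: matrix_left_invertible_ker)
  then obtain M where "N ** M = mat 1" using matrix_left_right_inverse by blast
  then show ?thesis by (metis matrix_vector_mul_assoc matrix_vector_mul_lid)
qed

definition M where "M = (SOME M. \<forall>v. N *v (M *v v) = v)"

lemma N_mult_M: "N *v (M *v v) = v"
  using someI_ex[OF N_inverse] by (simp add: M_def)

text \<open>
  \<open>Q\<close> is an invertible linear image of \<open>Y(p)\<close>; its components are the coordinates of the homogeneous
  part of the solution, so that \<open>\<Lambda>[Z] = c - Q\<close> for the part \<open>Z\<close> that vanishes at \<open>p\<close>.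
\<close>
definition Q where "Q \<omega> = M *v Y p \<omega>"

definition Z where "Z t \<omega> = Y t \<omega> - (\<Sum>k\<in>UNIV. Q \<omega> $ k *\<^sub>R \<psi> k t)"

lemma Y_decomp: "Y t \<omega> = Z t \<omega> + (\<Sum>k\<in>UNIV. Q \<omega> $ k *\<^sub>R \<psi> k t)"
  by (simp add: Z_def)

lemma Y_p: "Y p \<omega> = (\<Sum>k\<in>UNIV. Q \<omega> $ k *\<^sub>R \<psi> k p)"
  using N_mult_M[of "Y p \<omega>"] by (simp add: N_mult Q_def)

text \<open>Row by row reading of \<Lambda>[Z] = c - Q. Coordinate \<open>i\<close> involves
  \<open>Z\<close> only on the support of row \<open>i\<close>; this is where one-sidedness of rows
  enters.\<close>

lemma Q_component:
  assumes "\<omega> \<in> space P"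
  shows "Q \<omega> $ i = c $ i - (\<Sum>j\<in>UNIV. \<alpha> $ i $ j * last_component (Z (\<tau> j) \<omega>))"
proof -
  have "boundary \<alpha> \<tau> (\<lambda>t. Z t \<omega>) = c - Q \<omega>"
    unfolding Z_def boundary_diff by (simp add: Y_boundary[OF assms] boundary_\<psi>)
  then have "boundary \<alpha> \<tau> (\<lambda>t. Z t \<omega>) $ i = c $ i - Q \<omega> $ i" by simp
  then show ?thesis by (simp add: boundary_def)
qed

lemma Z_cont: "\<omega> \<in> space P \<Longrightarrow> continuous_on {0..1} (\<lambda>t. Z t \<omega>)"
  unfolding Z_def using \<psi>(1)
  by (intro continuous_intros Y_cont) (auto simp: homogeneous_def)

text \<open>Subtracting the equation at \<open>p\<close>, where \<open>Z\<close> is 0, leaves the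
  noise only through its increments from \<open>p\<close>, in the first component;
  \<open>Min UNIV\<close> is the index at position 1.\<close>

lemma Z_eq:
  assumes \<omega>: "\<omega> \<in> space P" and t: "t \<in> {0..1}"
  shows "Z t \<omega> = (\<omega> t - \<omega> p) *\<^sub>R axis (Min UNIV) 1 -
    (integral {0..t} (\<lambda>s. A s *v Z s \<omega>) - integral {0..p} (\<lambda>s. A s *v Z s \<omega>))"
proof -
  let ?z = "\<lambda>t. \<Sum>k\<in>UNIV. Q \<omega> $ k *\<^sub>R \<psi> k t"
  have hz: "homogeneous ?z" by (rule homogeneous_sum_scaleR) (auto simp: \<psi>)
  then have cz: "continuous_on {0..1} ?z" by (simp add: homogeneous_def)
  have *: "Z t \<omega> - Z 0 \<omega> + integral {0..t} (\<lambda>s. A s *v Z s \<omega>) = noise t \<omega>" if t: "t \<in> {0..1}" for t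
  proof -
    have "?z t - ?z 0 + integral {0..t} (\<lambda>s. A s *v ?z s) = 0" using hz t unfolding homogeneous_def by blast
    then show ?thesis
      unfolding Z_def integral_mult_diff[OF Y_cont[OF \<omega>] cz t] using Y_eq[OF \<omega> t]
      by (simp add: algebra_simps)
  qed
  have pos1: "pos (i :: 'n) = Suc 0 \<longleftrightarrow> i = Min UNIV" for i
  proof -
    have "pos (Min UNIV :: 'n) = Suc 0"
    proof -
      have "{..Min UNIV :: 'n} = {Min UNIV}" by (auto intro: antisym)
      then show ?thesis by (simp add: pos_def)
    qed
    then show ?thesis using pos_eq_iff[of i "Min UNIV"] by auto
  qed
  have "noise t \<omega> - noise p \<omega> = (\<omega> t - \<omega> p) *\<^sub>R axis (Min UNIV :: 'n) (1::real)"
    by (auto simp: noise_def vec_eq_iff axis_def pos1)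
  moreover have "Z p \<omega> = 0" by (simp add: Z_def flip: Y_p)
  ultimately show ?thesis
    using *[OF t] *[OF p01] by (simp add: algebra_simps)
qed

lemma Z_measurable:
  assumes "space F = space P" and T: "{u..v} \<subseteq> {0..1}" "p \<in> {u..v}" "t \<in> {u..v}"
    and meas: "\<And>s. s \<in> {u..v} \<Longrightarrow> (\<lambda>\<omega>. \<omega> s - \<omega> p) \<in> borel_measurable F"
  shows "Z t \<in> borel_measurable F"
proof (rule linear_integral_equation_measurable[OF A_cont, where b="\<lambda>s \<omega>. (\<omega> s - \<omega> p) *\<^sub>R axis (Min UNIV) 1" and u=u and v=v and p=p])
  show "continuous_on {0..1} (\<lambda>s. (\<omega> s - \<omega> p) *\<^sub>R axis (Min UNIV) (1::real))" if "\<omega> \<in> space F" for \<omega> :: "real \<Rightarrow> real"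
    using that assms(1) by (intro continuous_intros) (auto simp: space_wiener[OF W])
  show "continuous_on {0..1} (\<lambda>t. Z t \<omega>)" if "\<omega> \<in> space F" for \<omega>
    using Z_cont that assms(1) by simp
  show "Z t \<omega> = (\<omega> t - \<omega> p) *\<^sub>R axis (Min UNIV) 1 -
      (integral {0..t} (\<lambda>s. A s *v Z s \<omega>) - integral {0..p} (\<lambda>s. A s *v Z s \<omega>))"
    if "t \<in> {0..1}" "\<omega> \<in> space F" for t \<omega>
    using Z_eq that assms(1) by simp
  show "(\<lambda>\<omega>. (\<omega> s - \<omega> p) *\<^sub>R axis (Min UNIV) (1::real)) \<in> borel_measurable F" if "s \<in> {u..v}" for s
    using meas[OF that] by (intro borel_measurable_scaleR borel_measurable_const)
qed (fact T)+

lemma Q_measurable: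
  assumes sp: "space F = space P"
    and Z: "\<And>j. \<alpha> $ i $ j \<noteq> 0 \<Longrightarrow> Z (\<tau> j) \<in> borel_measurable F"
  shows "(\<lambda>\<omega>. Q \<omega> $ i) \<in> borel_measurable F"
proof -
  have "(\<lambda>\<omega>. c $ i - (\<Sum>j\<in>UNIV. \<alpha> $ i $ j * last_component (Z (\<tau> j) \<omega>))) \<in> borel_measurable F"
  proof (intro borel_measurable_diff borel_measurable_sum measurable_const)
    show "(\<lambda>\<omega>. \<alpha> $ i $ j * last_component (Z (\<tau> j) \<omega>)) \<in> borel_measurable F" for j
      using borel_measurable_last_component[OF Z] by (cases "\<alpha> $ i $ j = 0") auto
  qed simp
  moreover have "(\<lambda>\<omega>. Q \<omega> $ i) \<in> borel_measurable F \<longleftrightarrow>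
      (\<lambda>\<omega>. c $ i - (\<Sum>j\<in>UNIV. \<alpha> $ i $ j * last_component (Z (\<tau> j) \<omega>))) \<in> borel_measurable F"
    using Q_component sp by (intro measurable_cong) auto
  ultimately show ?thesis by simp
qed

lemma Y_measurable:
  assumes "Z t \<in> borel_measurable F" "\<And>k. (\<lambda>\<omega>. Q \<omega> $ k) \<in> borel_measurable F"
  shows "Y t \<in> borel_measurable F"
proof -
  have "(\<lambda>\<omega>. Z t \<omega> + (\<Sum>k\<in>UNIV. Q \<omega> $ k *\<^sub>R \<psi> k t)) \<in> borel_measurable F"
    using assms by (intro borel_measurable_add borel_measurable_sum borel_measurable_scaleR) auto
  then show ?thesis by (simp flip: Y_decomp)
qed

lemma Q_measurable_Y_p: "(\<lambda>\<omega>. Q \<omega> $ k) \<in> borel_measurable (generated_sigma (space P) Y {p})"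
proof (rule borel_measurable_vec_component)
  show "Q \<in> borel_measurable (generated_sigma (space P) Y {p})"
    unfolding Q_def[abs_def]
    by (rule measurable_compose[OF measurable_generated_sigma
          borel_measurable_continuous_onI[OF linear_continuous_on[OF matrix_vector_mul_bounded_linear]]]) simp
qed

abbreviation "cyl \<equiv> generated_sigma (space P) (\<lambda>t \<omega>. \<omega> t :: real) {0..1}"

text \<open>Measurability in the coordinate sigma-field, not merely in \<open>P\<close>, lets the
  shift argument act on events defined by \<open>Y\<close>.\<close>

lemma Y_measurable_cyl:
  assumes "t \<in> {0..1}"
  shows "Y t \<in> borel_measurable cyl"
proof -
  have Zm: "Z t \<in> borel_measurable cyl" if "t \<in> {0..1}" for t
    using that p01
    by (intro Z_measurable[where u=0 and v=1] borel_measurable_diff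
        measurable_generated_sigma[where X="\<lambda>t \<omega>. \<omega> t :: real"]) auto
  show ?thesis
    using assms \<tau>01 by (intro Y_measurable Q_measurable Zm) auto
qed

lemma subalgebra_cyl: "subalgebra P cyl"
  by (intro subalgebra_generated_sigma wiener_measurable[OF W]) auto

lemma subalgebra_Y:
  assumes "T \<subseteq> {0..1}"
  shows "subalgebra P (generated_sigma (space P) Y T)"
  using assms measurable_from_subalg[OF subalgebra_cyl Y_measurable_cyl]
  by (intro subalgebra_generated_sigma) auto

text \<open>Row \<open>i\<close> with left support makes Q_i a function of the past increments
  \<open>L\<close>, the other rows a function of the future increments \<open>R\<close>. These two
  groups of coordinates are \<open>H1\<close> and \<open>H2\<close>; together they recover
  \<open>Y p\<close>.\<close>

lemma cond_indep_one_sided: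
  assumes side: "\<And>i. boundary_supp \<alpha> \<tau> i \<subseteq> {0..<p} \<or> boundary_supp \<alpha> \<tau> i \<subseteq> {p<..1}"
  shows "cond_indep P (generated_sigma (space P) Y {0..p}) (generated_sigma (space P) Y {p..1})
    (generated_sigma (space P) Y {p})"
proof -
  define I where "I = {i. boundary_supp \<alpha> \<tau> i \<subseteq> {0..<p}}"
  define L where "L = generated_sigma (space P) (\<lambda>t \<omega>. \<omega> t - \<omega> p) {0..p}"
  define R where "R = generated_sigma (space P) (\<lambda>t \<omega>. \<omega> t - \<omega> p) {p..1}"
  define H where "H = generated_sigma (space P) Y {p}"
  define H1 where "H1 = generated_sigma (space P) (\<lambda>i \<omega>. Q \<omega> $ i) I"
  define H2 where "H2 = generated_sigma (space P) (\<lambda>i \<omega>. Q \<omega> $ i) (- I)"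
  have sp [simp]: "space L = space P" "space R = space P" "space H = space P" "space H1 = space P" "space H2 = space P"
    by (simp_all add: L_def R_def H_def H1_def H2_def)
  have incr: "(\<lambda>\<omega>. \<omega> s - \<omega> p) \<in> borel_measurable L" if "s \<in> {0..p}" for s
    unfolding L_def using that by (rule measurable_generated_sigma)
  have incr': "(\<lambda>\<omega>. \<omega> s - \<omega> p) \<in> borel_measurable R" if "s \<in> {p..1}" for s
    unfolding R_def using that by (rule measurable_generated_sigma)
  have ZL: "Z t \<in> borel_measurable L" if "t \<in> {0..p}" for t
    using that p01 incr by (intro Z_measurable[where u=0 and v=p]) auto
  have ZR: "Z t \<in> borel_measurable R" if "t \<in> {p..1}" for t
    using that p01 incr' by (intro Z_measurable[where u=p and v=1]) auto
  have QL: "(\<lambda>\<omega>. Q \<omega> $ i) \<in> borel_measurable L" if "i \<in> I" for i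
    using that by (intro Q_measurable ZL) (auto simp: I_def boundary_supp_def)
  have QR: "(\<lambda>\<omega>. Q \<omega> $ i) \<in> borel_measurable R" if "i \<in> - I" for i
  proof (intro Q_measurable ZR)
    fix j assume "\<alpha> $ i $ j \<noteq> 0"
    moreover have "boundary_supp \<alpha> \<tau> i \<subseteq> {p<..1}" using side[of i] that by (auto simp: I_def)
    ultimately show "\<tau> j \<in> {p..1}" by (force simp: boundary_supp_def)
  qed simp
  have Q1: "(\<lambda>\<omega>. Q \<omega> $ i) \<in> borel_measurable H1" if "i \<in> I" for i
    unfolding H1_def using that by (rule measurable_generated_sigma)
  have Q2: "(\<lambda>\<omega>. Q \<omega> $ i) \<in> borel_measurable H2" if "i \<in> - I" for i
    unfolding H2_def using that by (rule measurable_generated_sigma)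
  have join: "subalgebra (sigma (space P) (sets X \<union> sets X')) X" "subalgebra (sigma (space P) (sets X \<union> sets X')) X'"
    "sets (sigma (space P) (sets X \<union> sets X')) = sigma_sets (space P) (sets X \<union> sets X')"
    if "space X = space P" "space X' = space P" for X X' :: "(real \<Rightarrow> real) measure"
  proof -
    have "sets X \<union> sets X' \<subseteq> Pow (space P)" using that sets.space_closed by blast
    then show "sets (sigma (space P) (sets X \<union> sets X')) = sigma_sets (space P) (sets X \<union> sets X')"
      by (rule sets_measure_of)
    then show "subalgebra (sigma (space P) (sets X \<union> sets X')) X" "subalgebra (sigma (space P) (sets X \<union> sets X')) X'"
      using that by (auto simp: subalgebra_def space_measure_of_conv)
  qed
  show ?thesis
    unfolding H_def[symmetric]
  proof (rule cond_indep_of_indep[of L R H _ _ H1 H2])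
    show "subalgebra P L" "subalgebra P R"
      unfolding L_def R_def using p01
      by (auto intro!: subalgebra_generated_sigma borel_measurable_diff wiener_measurable[OF W])
    show "subalgebra P H" unfolding H_def using p01 by (intro subalgebra_Y) auto
    show "subalgebra P (generated_sigma (space P) Y {0..p})" "subalgebra P (generated_sigma (space P) Y {p..1})"
      using p01 by (auto intro!: subalgebra_Y)
    show "subalgebra L H1" "subalgebra R H2"
      unfolding H1_def H2_def using QL QR by (auto intro!: subalgebra_generated_sigma)
    show "subalgebra H H1" "subalgebra H H2"
      unfolding H1_def H2_def using Q_measurable_Y_p by (auto intro!: subalgebra_generated_sigma simp: H_def)
    show "prob (A \<inter> B) = prob A * prob B" if "A \<in> sets L" "B \<in> sets R" for A B
      using wiener_past_future_indep[OF W p01] that by (simp add: L_def R_def)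
    let ?H12 = "sigma (space P) (sets H1 \<union> sets H2)"
    have Q12: "(\<lambda>\<omega>. Q \<omega> $ k) \<in> borel_measurable ?H12" for k
      using measurable_from_subalg[OF join(1)[of H1 H2] Q1] measurable_from_subalg[OF join(2)[of H1 H2] Q2]
      by (cases "k \<in> I") auto
    have "Y p \<in> borel_measurable ?H12"
    proof -
      have "(\<lambda>\<omega>. \<Sum>k\<in>UNIV. Q \<omega> $ k *\<^sub>R \<psi> k p) \<in> borel_measurable ?H12"
        using Q12 by (intro borel_measurable_sum borel_measurable_scaleR) auto
      then show ?thesis by (simp flip: Y_p)
    qed
    then have "sets H \<subseteq> sets ?H12"
      unfolding H_def by (intro sets_generated_sigma_subset) (auto simp: space_measure_of_conv)
    then show "sets H \<subseteq> sigma_sets (space P) (sets H1 \<union> sets H2)"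
      using join(3)[of H1 H2] by simp
    \<comment> \<open>For the past, \<open>L\<close> supplies \<open>Z\<close> on
      \<open>{0..p}\<close> and the coordinates in \<open>I\<close>; the remaining coordinates come
      from \<open>H2\<close>. The future is symmetric.\<close>
    let ?LH = "sigma (space P) (sets L \<union> sets H2)"
    have "(\<lambda>\<omega>. Q \<omega> $ k) \<in> borel_measurable ?LH" for k
      using measurable_from_subalg[OF join(1)[of L H2] QL] measurable_from_subalg[OF join(2)[of L H2] Q2]
      by (cases "k \<in> I") auto
    moreover have "Z t \<in> borel_measurable ?LH" if "t \<in> {0..p}" for t
      using measurable_from_subalg[OF join(1)[of L H2] ZL[OF that]] by simp
    ultimately have "sets (generated_sigma (space P) Y {0..p}) \<subseteq> sets ?LH"
      by (intro sets_generated_sigma_subset Y_measurable) (auto simp: space_measure_of_conv)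
    then show "sets (generated_sigma (space P) Y {0..p}) \<subseteq> sigma_sets (space P) (sets L \<union> sets H2)"
      using join(3)[of L H2] by simp
    let ?RH = "sigma (space P) (sets R \<union> sets H1)"
    have "(\<lambda>\<omega>. Q \<omega> $ k) \<in> borel_measurable ?RH" for k
      using measurable_from_subalg[OF join(1)[of R H1] QR] measurable_from_subalg[OF join(2)[of R H1] Q1]
      by (cases "k \<in> I") auto
    moreover have "Z t \<in> borel_measurable ?RH" if "t \<in> {p..1}" for t
      using measurable_from_subalg[OF join(1)[of R H1] ZR[OF that]] by simp
    ultimately have "sets (generated_sigma (space P) Y {p..1}) \<subseteq> sets ?RH"
      by (intro sets_generated_sigma_subset Y_measurable) (auto simp: space_measure_of_conv)
    then show "sets (generated_sigma (space P) Y {p..1}) \<subseteq> sigma_sets (space P) (sets R \<union> sets H1)"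
      using join(3)[of R H1] by simp
  qed
qed

text \<open>
  A two-sided row \<open>i\<close> gives a kernel vector \<open>x\<close> of \<open>\<alpha>\<close>, a column outside the basic ones corrected by
  basic columns, whose left part is not in the kernel of row \<open>i\<close>. Interpolating \<open>x\<close> at the points
  \<open>\<tau> j\<close> by a path that vanishes at \<open>p\<close> gives a shift of the noise that moves the left part of
  \<open>\<Lambda>\<^sub>i\<close> but not \<open>Y(p)\<close>.
\<close>
lemma separating_poly:
  assumes j: "\<alpha> $ i $ j1 \<noteq> 0" "\<tau> j1 < p" "\<alpha> $ i $ j2 \<noteq> 0" "p < \<tau> j2"
  obtains q where "boundary \<alpha> \<tau> (poly_path q) = 0" "poly_path q p = (0 :: real^'n::{finite,linorder})"
    "(\<Sum>j | \<tau> j < p. \<alpha> $ i $ j * poly q (\<tau> j)) \<noteq> 0"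
proof -
  \<comment> \<open>One of \<open>j1\<close>, \<open>j2\<close> lies across \<open>p\<close> from
    \<open>\<tau> (f i)\<close>. It is not a basic column: it differs from \<open>f i\<close>, and
    the other basic columns have entry 0 in row \<open>i\<close>.\<close>
  obtain j0 where j0: "\<alpha> $ i $ j0 \<noteq> 0" "\<tau> j0 < p \<longleftrightarrow> \<not> \<tau> (f i) < p"
    using j by (cases "\<tau> (f i) < p") (auto dest: less_asym)
  define v where "v k = \<alpha> $ k $ j0" for k
  define x where "x j = (if j = j0 then 1 else 0) - (\<Sum>k\<in>UNIV. if j = f k then v k else 0)" for j
  have x0: "x j = 0" if "\<tau> j = p" for j
  proof -
    have "j \<noteq> j0" "\<And>k. j \<noteq> f k" using that p_supp[OF j0(1)] basic_column_not_p by auto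
    then show ?thesis by (simp add: x_def)
  qed
  obtain q where q: "\<And>j. poly q (\<tau> j) = x j" "\<And>k. k < CARD('n) \<Longrightarrow> poly ((pderiv ^^ k) q) p = 0"
    by (rule interpolation_poly_root[where n="CARD('n)" and p=p and x=x and \<tau>=\<tau>]) (use inj_\<tau> x0 in auto)
  have "(\<Sum>j\<in>UNIV. \<alpha> $ r $ j * x j) = 0" for r
  proof -
    have "(\<Sum>j\<in>UNIV. \<alpha> $ r $ j * x j) = (\<Sum>j\<in>UNIV. if j = j0 then \<alpha> $ r $ j else 0)
        - (\<Sum>j\<in>UNIV. \<alpha> $ r $ j * (\<Sum>k\<in>UNIV. if j = f k then v k else 0))"
      unfolding sum_subtractf[symmetric] x_def by (intro sum.cong) (auto simp: right_diff_distrib)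
    also have "\<dots> = 0" unfolding sum_basic_columns by (simp add: v_def)
    finally show ?thesis .
  qed
  then have 1: "boundary \<alpha> \<tau> (poly_path q) = 0"
    by (simp add: boundary_def vec_eq_iff q)
  have 2: "poly_path q p = (0 :: real^'n::{finite,linorder})"
  proof -
    have "CARD('n) - pos k < CARD('n)" for k :: 'n using pos_bounds[of k] by linarith
    then show ?thesis by (simp add: poly_path_def vec_eq_iff q)
  qed
  have row: "\<alpha> $ i $ j * (\<Sum>k\<in>UNIV. if j = f k then v k else 0) = (if j = f i then v i else 0)" for j
  proof (cases "\<exists>k. j = f k")
    case True
    then obtain k where k: "j = f k" by blast
    have "(\<Sum>k'\<in>UNIV. if j = f k' then v k' else 0) = (\<Sum>k'\<in>UNIV. if k' = k then v k' else 0)"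
      using injD[OF inj_f] by (intro sum.cong) (auto simp: k)
    then show ?thesis using injD[OF inj_f, of k i] by (auto simp: k f)
  qed auto
  \<comment> \<open>In row \<open>i\<close> only \<open>j0\<close> and \<open>f i\<close>
    contribute, with opposite values; lying on different sides of \<open>p\<close>, exactly one of
    them is counted.\<close>
  have "(\<Sum>j | \<tau> j < p. \<alpha> $ i $ j * poly q (\<tau> j)) =
      (\<Sum>j | \<tau> j < p. (if j = j0 then v i else 0) - (if j = f i then v i else 0))"
    unfolding q x_def right_diff_distrib row by (intro sum.cong) (auto simp: v_def)
  also have "\<dots> = (if \<tau> j0 < p then v i else 0) - (if \<tau> (f i) < p then v i else 0)"
    by (simp add: sum_subtractf)
  also have "\<dots> \<noteq> 0" using j0 by (auto simp: v_def)
  finally show thesis using that 1 2 by blast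
qed

lemma one_sided_of_cond_indep:
  assumes ci: "cond_indep P (generated_sigma (space P) Y {0..p}) (generated_sigma (space P) Y {p..1})
      (generated_sigma (space P) Y {p})"
    and j: "\<alpha> $ i $ j1 \<noteq> 0" "\<tau> j1 < p" "\<alpha> $ i $ j2 \<noteq> 0" "p < \<tau> j2"
  shows False
proof -
  define F where "F = generated_sigma (space P) Y {0..p}"
  define G where "G = generated_sigma (space P) Y {p..1}"
  define H where "H = generated_sigma (space P) Y {p}"
  have sp [simp]: "space F = space P" "space G = space P" by (simp_all add: F_def G_def)
  obtain q where q: "boundary \<alpha> \<tau> (poly_path q) = 0" "poly_path q p = (0 :: real^'n::{finite,linorder})"
    "(\<Sum>j | \<tau> j < p. \<alpha> $ i $ j * poly q (\<tau> j)) \<noteq> 0"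
    using separating_poly[OF j] .
  define h where "h = poly_noise a TYPE('n) q"
  define \<kappa> where "\<kappa> = (\<Sum>j | \<tau> j < p. \<alpha> $ i $ j * poly q (\<tau> j))"
  define X where "X \<omega> = (\<Sum>j | \<tau> j < p. \<alpha> $ i $ j * last_component (Y (\<tau> j) \<omega>))" for \<omega>
  \<comment> \<open>As \<Lambda> annihilates the polynomial path, the homogeneous remainder has
    boundary value 0 and well-posedness removes it.\<close>
  have shift: "Y t (path_shift h \<omega>) = Y t \<omega> + poly_path q t" if "\<omega> \<in> space P" "t \<in> {0..1}" for t \<omega>
  proof -
    have "boundary \<alpha> \<tau> (\<lambda>t. Y t (path_shift h \<omega>) - Y t \<omega> - poly_path q t) = 0"
      unfolding boundary_diff h_def using Y_boundary path_shift_space that q(1) by simp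
    from homogeneous_zero_boundary[OF homogeneous_shift[OF that(1)] this[unfolded h_def] that(2)]
    show ?thesis by (simp add: h_def algebra_simps)
  qed
  have X_shift: "X (path_shift h \<omega>) = X \<omega> + \<kappa>" if "\<omega> \<in> space P" for \<omega>
  proof -
    have "last_component (x + y) = last_component x + last_component y" for x y :: "real^'n::{finite,linorder}"
      by (simp add: last_component_def)
    then show ?thesis
      using shift[OF that \<tau>01] by (simp add: X_def \<kappa>_def distrib_left sum.distrib)
  qed
  have Ym: "(\<lambda>\<omega>. last_component (Y t \<omega>)) \<in> borel_measurable (generated_sigma (space P) Y T)" if "t \<in> T" for t T
    by (intro borel_measurable_last_component measurable_generated_sigma that)
  have XF: "X \<in> borel_measurable F"
    unfolding X_def[abs_def] F_def using \<tau>01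
    by (intro borel_measurable_sum borel_measurable_times borel_measurable_const Ym) auto
  have XG: "X \<in> borel_measurable G"
  proof -
    \<comment> \<open>The boundary condition expresses the left part of the row through the times at
      or after \<open>p\<close>.\<close>
    have "X \<omega> = c $ i - (\<Sum>j | \<not> \<tau> j < p. \<alpha> $ i $ j * last_component (Y (\<tau> j) \<omega>))" if "\<omega> \<in> space P" for \<omega>
    proof -
      have "c $ i = (\<Sum>j\<in>UNIV. \<alpha> $ i $ j * last_component (Y (\<tau> j) \<omega>))"
        using Y_boundary[OF that] by (auto simp: boundary_def vec_eq_iff)
      also have "\<dots> = X \<omega> + (\<Sum>j | \<not> \<tau> j < p. \<alpha> $ i $ j * last_component (Y (\<tau> j) \<omega>))"
        unfolding X_def by (subst sum.union_disjoint[symmetric]) (auto intro: sum.cong)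
      finally show ?thesis by simp
    qed
    then have "X \<in> borel_measurable G \<longleftrightarrow>
        (\<lambda>\<omega>. c $ i - (\<Sum>j | \<not> \<tau> j < p. \<alpha> $ i $ j * last_component (Y (\<tau> j) \<omega>))) \<in> borel_measurable G"
      by (intro measurable_cong) auto
    moreover have "(\<lambda>\<omega>. c $ i - (\<Sum>j | \<not> \<tau> j < p. \<alpha> $ i $ j * last_component (Y (\<tau> j) \<omega>))) \<in> borel_measurable G"
      unfolding G_def using \<tau>01
      by (intro borel_measurable_diff borel_measurable_sum borel_measurable_times borel_measurable_const Ym) (auto simp: not_less)
    ultimately show ?thesis by simp
  qed
  have XC: "X \<in> borel_measurable cyl"
    unfolding X_def[abs_def] using \<tau>01
    by (intro borel_measurable_sum borel_measurable_times borel_measurable_const borel_measurable_last_component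
        Y_measurable_cyl) auto
  obtain C where lip: "\<And>s t. s \<in> {0..1} \<Longrightarrow> t \<in> {0..1} \<Longrightarrow> \<bar>h t - h s\<bar> \<le> C * \<bar>t - s\<bar>"
    using ctrl_lipschitz[where q=q] unfolding h_def by blast
  have inv: "AE \<omega> in P. X \<omega> \<le> r \<longleftrightarrow> X \<omega> + \<kappa> \<le> r" for r :: real
  proof -
    define E where "E = {\<omega> \<in> space P. X \<omega> \<le> r}"
    have EF: "E \<in> sets F" "E \<in> sets G" "E \<in> sets cyl"
      unfolding E_def
      using measurable_sets[OF XF, of "{..r}"] measurable_sets[OF XG, of "{..r}"] measurable_sets[OF XC, of "{..r}"]
      by (auto simp: vimage_def Int_def conj_commute)
    obtain D where D: "D \<in> sets H" "AE \<omega> in P. \<omega> \<in> E \<longleftrightarrow> \<omega> \<in> D"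
      using cond_indep_common_event[OF ci[folded F_def G_def H_def] EF(1,2)] .
    then obtain S where S: "D = Y p -` S \<inter> space P" "S \<in> sets borel"
      by (auto simp: H_def sets_generated_sigma_singleton)
    have DC: "D \<in> sets cyl"
      using measurable_sets[OF Y_measurable_cyl[OF p01] S(2)] by (simp add: S(1))
    \<comment> \<open>The discrepancy between \<open>E\<close> and its version \<open>D\<close> is
      null before and after the shift. \<open>D\<close> depends on \<open>Y p\<close> alone and is
      invariant, so \<open>E\<close> is almost surely invariant too.\<close>
    have N: "sym_diff E D \<in> sets cyl" using EF(3) DC by auto
    have "prob (sym_diff E D) = 0"
    proof (rule measure_eq_0_null_sets, rule AE_iff_null_sets[THEN iffD2])
      show "sym_diff E D \<in> events" using N subalgebra_cyl by (auto simp: subalgebra_def)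
      show "AE \<omega> in P. \<omega> \<notin> sym_diff E D" using D(2) by (auto elim!: eventually_mono)
    qed
    have "AE \<omega> in P. path_shift h \<omega> \<notin> sym_diff E D"
      by (rule cameron_martin_null_sets[OF W _ lip N \<open>prob (sym_diff E D) = 0\<close>])
        (auto simp: h_def ctrl_zero)
    then have "AE \<omega> in P. path_shift h \<omega> \<notin> sym_diff E D \<and> (\<omega> \<in> E \<longleftrightarrow> \<omega> \<in> D) \<and> \<omega> \<in> space P"
      using D(2) AE_space by eventually_elim auto
    then show ?thesis
    proof (rule eventually_mono)
      fix \<omega> assume *: "path_shift h \<omega> \<notin> sym_diff E D \<and> (\<omega> \<in> E \<longleftrightarrow> \<omega> \<in> D) \<and> \<omega> \<in> space P"
      then have \<omega>: "\<omega> \<in> space P" and \<omega>': "path_shift h \<omega> \<in> space P"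
        using path_shift_space by (auto simp: h_def)
      have "path_shift h \<omega> \<in> D \<longleftrightarrow> \<omega> \<in> D"
        using shift[OF \<omega> p01] \<omega> \<omega>' q(2) by (simp add: S(1))
      then show "X \<omega> \<le> r \<longleftrightarrow> X \<omega> + \<kappa> \<le> r"
        using * \<omega> \<omega>' X_shift[OF \<omega>] by (auto simp: E_def)
    qed
  qed
  \<comment> \<open>Countably many levels merge into one null set, and rationals are dense enough to
    separate \<open>X \<omega>\<close> from \<open>X \<omega> + \<kappa>\<close>.\<close>
  have "AE \<omega> in P. \<forall>r::rat. X \<omega> \<le> of_rat r \<longleftrightarrow> X \<omega> + \<kappa> \<le> of_rat r"
    unfolding AE_all_countable using inv by blast
  moreover have "\<not> (\<forall>r::rat. x \<le> of_rat r \<longleftrightarrow> x + \<kappa> \<le> of_rat r)" for x :: real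
  proof (cases "\<kappa> > 0")
    case True
    then obtain r where "x < of_rat r" "of_rat r < x + \<kappa>" using of_rat_dense[of x "x + \<kappa>"] by auto
    then show ?thesis by (intro notI) (metis less_imp_le not_le)
  next
    case False
    then have "x + \<kappa> < x" using q(3) by (simp add: \<kappa>_def)
    then obtain r where "x + \<kappa> < of_rat r" "of_rat r < x" using of_rat_dense by blast
    then show ?thesis by (intro notI) (metis less_imp_le not_le)
  qed
  ultimately have "AE \<omega> in P. False" by (auto elim!: eventually_mono)
  then show False by simp
qed

end

theorem theorem4p11:
  fixes P :: "(real \<Rightarrow> real) measure"
    and a :: "nat \<Rightarrow> real \<Rightarrow> real"
    and \<alpha> :: "real^'m::{finite,linorder}^'n::{finite,linorder}"
    and \<tau> :: "'m \<Rightarrow> real"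
    and c :: "real^'n::{finite,linorder}"
    and Y :: "real \<Rightarrow> (real \<Rightarrow> real) \<Rightarrow> real^'n::{finite,linorder}"
    and p :: real
  assumes "wiener_measure P"
    and "\<And>k. k < CARD('n) \<Longrightarrow> continuous_on {0..1} (a k)"
    and "CARD('n) \<le> CARD('m)"
    and "strict_mono \<tau>" and "range \<tau> \<subseteq> {0..1}"
    and "rank \<alpha> = CARD('n)"
    and "basic_form \<alpha>"
    and "well_posed a \<alpha> \<tau>"
    and "\<And>\<omega>. \<omega> \<in> space P \<Longrightarrow> path_solution a \<alpha> \<tau> c \<omega> (\<lambda>t. Y t \<omega>)"
    and "0 \<le> p" and "p \<le> 1"
    and "p \<notin> (\<Union>i. boundary_supp \<alpha> \<tau> i)"
  shows "cond_indep P
           (generated_sigma (space P) Y {0..p})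
           (generated_sigma (space P) Y {p..1})
           (generated_sigma (space P) Y {p})
         \<longleftrightarrow> (\<forall>i. boundary_supp \<alpha> \<tau> i \<subseteq> {0..<p} \<or> boundary_supp \<alpha> \<tau> i \<subseteq> {p<..1})"
proof -
  obtain f :: "'n \<Rightarrow> 'm" where f: "inj f" "(\<chi> i k. \<alpha> $ i $ f k) = mat 1"
    using assms(7) by (auto simp: basic_form_def)
  interpret wiener_boundary_problem P a \<alpha> \<tau> c Y p f
  proof
    show "\<alpha> $ i $ f k = (if i = k then 1 else 0)" for i k
      using f(2) by (auto simp: vec_eq_iff mat_def)
    show "\<tau> j \<in> {0..1}" for j using assms(5) by blast
  qed (use assms f(1) in \<open>auto simp: boundary_supp_def strict_mono_imp_inj_on\<close>)
  show ?thesis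
  proof
    assume ci: "cond_indep P (generated_sigma (space P) Y {0..p}) (generated_sigma (space P) Y {p..1})
      (generated_sigma (space P) Y {p})"
    show "\<forall>i. boundary_supp \<alpha> \<tau> i \<subseteq> {0..<p} \<or> boundary_supp \<alpha> \<tau> i \<subseteq> {p<..1}"
    proof (rule ccontr)
      assume "\<not> ?thesis"
      then obtain i j1 j2 where j: "\<alpha> $ i $ j1 \<noteq> 0" "\<tau> j1 \<notin> {p<..1}" "\<alpha> $ i $ j2 \<noteq> 0" "\<tau> j2 \<notin> {0..<p}"
        unfolding boundary_supp_def by blast
      \<comment> \<open>Support points differ from \<open>p\<close>, so a point not to the right of
        \<open>p\<close> is strictly to its left, and conversely.\<close>
      then have "\<tau> j1 < p" "p < \<tau> j2"
        using \<tau>01[of j1] \<tau>01[of j2] p_supp[OF j(1)] p_supp[OF j(3)] by auto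
      with one_sided_of_cond_indep[OF ci] j show False by blast
    qed
  qed (use cond_indep_one_sided in blast)
qed

end
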